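(* Let $G$ be a chordal graph and let $B$ be an induced complete bipartite subgraph of $G$ with bipartition sets $B_X=\{x\}$ and $B_Y=\{y_1,\dots,y_k\}$, $k \ge 1$. For each connected component $C$ of $G[M_2(B)]$ choose any vertex $w_C \in V(C)$ such that $|f(w_C)| = \max\{|f(w)| : w \in V(C)\}$, and let $S$ be the set of all the chosen vertices $w_C$. Then $B$ is a generating subgraph of $G$ if and only if $S$ dominates $M_1(B)$. Moreover, the algorithm that computes $M_1(B)$, $M_2(B)$, the connected components of $G[M_2(B)]$, the values $|f(w)|$ for $w\in M_2(B)$, such a set $S$, and then answers "generating" if $S$ dominates $M_1(B)$ and "not generating" otherwise, can be implemented in $O(|V(G)|^2)$ time.
   Context: All graphs are finite, simple and undirected. A graph is chordal if every induced cycle is a triangle. For a non-empty set $S$ of vertices and a vertex $u$, $d(u,S)=\min\{d(u,s): s\in S\}$, where $d$ is the graph distance; $N_i(S)=\{v\in V(G): d(v,S)=i\}$, $N_i[S]=\{v \in V(G): d(v,S)\le i\}$ for positive integers $i$, with $N_i(\emptyset)=N_i[\emptyset]=\emptyset$; $N_i(v)=N_i(\{v\})$. $G[S]$ is the subgraph induced by $S$. A set $S$ of vertices dominates a set $T$ of vertices if $T\subseteq N_1[S]$. Let $B$ be an induced complete bipartite subgraph with bipartition sets $B_X$ and $B_Y$. $B$ is generating if there exists an independent set $S$ of $G$ such that each of $S\cup B_X$ and $S\cup B_Y$ is a maximal (with respect to inclusion) independent set of $G$. For $\{U,V\}=\{X,Y\}$ and non-empty $S\subseteq B_V$ put $M_1(S)=N_1(S)\cap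 N_2(B_U)$ and $M_2(S)=N_1(M_1(S))\cap N_2(B_V)$. Put $M_1(B)=M_1(B_X)\cup M_1(B_Y)$ and $M_2(B)=M_2(B_X)\cup M_2(B_Y)$. For $w\in M_2(B)$, $f(w)=N_1(w)\cap M_1(B)$. *)

theory Defs
  imports "Graph_Theory.Graph_Theory" "HOL-Library.Landau_Symbols"
begin

section \<open>Graphs\<close>

text \<open>
  A finite simple undirected graph is a \<^locale>\<open>pair_graph\<close>: a finite, loop-free digraph whose arc set
  is a symmetric set of ordered pairs.
\<close>

definition gdist :: "'a pair_pre_digraph \<Rightarrow> 'a \<Rightarrow> 'a \<Rightarrow> ereal" where
  "gdist G u v = wf_digraph.\<mu> (with_proj G) (\<lambda>_. 1) u v"

text \<open>
  For a finite non-empty set the infimum is the minimum. For the empty set it is infinite, so that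
  both kinds of neighbourhoods of the empty set are empty.
\<close>

definition set_gdist :: "'a pair_pre_digraph \<Rightarrow> 'a \<Rightarrow> 'a set \<Rightarrow> ereal" where
  "set_gdist G u S = (INF s\<in>S. gdist G u s)"

definition nbhd :: "'a pair_pre_digraph \<Rightarrow> nat \<Rightarrow> 'a set \<Rightarrow> 'a set" where
  "nbhd G i S = {v \<in> pverts G. set_gdist G v S = ereal (real i)}"

definition closed_nbhd :: "'a pair_pre_digraph \<Rightarrow> nat \<Rightarrow> 'a set \<Rightarrow> 'a set" where
  "closed_nbhd G i S = {v \<in> pverts G. set_gdist G v S \<le> ereal (real i)}"

definition dominates_set :: "'a pair_pre_digraph \<Rightarrow> 'a set \<Rightarrow> 'a set \<Rightarrow> bool" where
  "dominates_set G S T \<longleftrightarrow> T \<subseteq> closed_nbhd G 1 S"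

text \<open>
  In a symmetric digraph the library's \<^const>\<open>pre_digraph.cycle\<close> also admits the closed walk that
  traverses one edge forth and back; hence the bound on the length. A cycle is induced if every edge
  between two of its vertices is one of its edges, in one of the two directions.
\<close>

definition induced_cycle :: "'a pair_pre_digraph \<Rightarrow> ('a \<times> 'a) awalk \<Rightarrow> bool" where
  "induced_cycle G p \<longleftrightarrow> pre_digraph.cycle (with_proj G) p \<and> length p \<ge> 3 \<and>
     arcs (with_proj G \<restriction> (fst ` set p)) \<subseteq> set p \<union> (set p)\<inverse>"

definition chordal :: "'a pair_pre_digraph \<Rightarrow> bool" where
  "chordal G \<longleftrightarrow> (\<forall>p. induced_cycle G p \<longrightarrow> length p = 3)"

definition independent_set :: "'a pair_pre_digraph \<Rightarrow> 'a set \<Rightarrow> bool" where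
  "independent_set G S \<longleftrightarrow> S \<subseteq> pverts G \<and> (\<forall>u\<in>S. \<forall>v\<in>S. (u, v) \<notin> parcs G)"

definition maximal_independent_set :: "'a pair_pre_digraph \<Rightarrow> 'a set \<Rightarrow> bool" where
  "maximal_independent_set G S \<longleftrightarrow>
     independent_set G S \<and> (\<forall>T. independent_set G T \<and> S \<subseteq> T \<longrightarrow> T = S)"

section \<open>Generating subgraphs\<close>

text \<open>
  An induced complete bipartite subgraph is represented by its two bipartition sets; they determine
  it, since it is the subgraph induced by their union.
\<close>

definition induced_complete_bipartite ::
    "'a pair_pre_digraph \<Rightarrow> 'a set \<Rightarrow> 'a set \<Rightarrow> bool" where
  "induced_complete_bipartite G X Y \<longleftrightarrow>
     X \<subseteq> pverts G \<and> Y \<subseteq> pverts G \<and> X \<noteq> {} \<and> Y \<noteq> {} \<and> X \<inter> Y = {} \<and>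
     arcs (with_proj G \<restriction> (X \<union> Y)) = X \<times> Y \<union> Y \<times> X"

definition generating :: "'a pair_pre_digraph \<Rightarrow> 'a set \<Rightarrow> 'a set \<Rightarrow> bool" where
  "generating G X Y \<longleftrightarrow> (\<exists>S. independent_set G S \<and>
     maximal_independent_set G (S \<union> X) \<and> maximal_independent_set G (S \<union> Y))"

text \<open>
  In \<open>M1_of G U S\<close> and \<open>M2_of G U V S\<close> the sets \<open>U\<close> and \<open>V\<close> are the two bipartition sets, in either
  order, and \<open>S\<close> is a non-empty subset of \<open>V\<close>.
\<close>

definition M1_of :: "'a pair_pre_digraph \<Rightarrow> 'a set \<Rightarrow> 'a set \<Rightarrow> 'a set" where
  "M1_of G U S = nbhd G 1 S \<inter> nbhd G 2 U"

definition M2_of :: "'a pair_pre_digraph \<Rightarrow> 'a set \<Rightarrow> 'a set \<Rightarrow> 'a set \<Rightarrow> 'a set" where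
  "M2_of G U V S = nbhd G 1 (M1_of G U S) \<inter> nbhd G 2 V"

definition M1 :: "'a pair_pre_digraph \<Rightarrow> 'a set \<Rightarrow> 'a set \<Rightarrow> 'a set" where
  "M1 G X Y = M1_of G Y X \<union> M1_of G X Y"

definition M2 :: "'a pair_pre_digraph \<Rightarrow> 'a set \<Rightarrow> 'a set \<Rightarrow> 'a set" where
  "M2 G X Y = M2_of G Y X X \<union> M2_of G X Y Y"

definition M1_nbrs :: "'a pair_pre_digraph \<Rightarrow> 'a set \<Rightarrow> 'a set \<Rightarrow> 'a \<Rightarrow> 'a set" where
  "M1_nbrs G X Y w = nbhd G 1 {w} \<inter> M1 G X Y"

text \<open>
  The vertex sets of the connected components of the subgraph induced by \<open>M2 G X Y\<close>. In a symmetric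
  digraph the strongly connected components are the connected components.
\<close>

definition M2_components :: "'a pair_pre_digraph \<Rightarrow> 'a set \<Rightarrow> 'a set \<Rightarrow> 'a set set" where
  "M2_components G X Y = pre_digraph.sccs_verts (with_proj G \<restriction> M2 G X Y)"

definition chosen_vertices :: "'a pair_pre_digraph \<Rightarrow> 'a set \<Rightarrow> 'a set \<Rightarrow> 'a set \<Rightarrow> bool" where
  "chosen_vertices G X Y S \<longleftrightarrow> (\<exists>w.
     (\<forall>C \<in> M2_components G X Y.
        w C \<in> C \<and>
        card (M1_nbrs G X Y (w C)) = Max ((\<lambda>v. card (M1_nbrs G X Y v)) ` C)) \<and>
     S = w ` M2_components G X Y)"

section \<open>A unit-cost random access machine\<close>

text \<open>
  Running time is measured on a word RAM with structured control flow. The memory consists of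
  finitely many arrays of words per program, each named by a string; a scalar variable is cell \<open>0\<close>
  of its array. Every constant, memory access, arithmetic operation, assignment and test costs one
  step. Words have \<open>b\<close> bits: a step that would produce a constant, an address or an intermediate
  result of more than \<open>b\<close> bits has no execution.
\<close>

type_synonym store = "string \<Rightarrow> nat \<Rightarrow> nat"

datatype expr =
    Const nat
  | Cell string expr
  | Add expr expr
  | Sub expr expr
  | Mul expr expr

datatype com =
    Skip
  | Assign string expr expr
  | Seq com com
  | Cond expr com com
  | While expr com

primrec val :: "store \<Rightarrow> expr \<Rightarrow> nat" where
  "val s (Const k) = k"
| "val s (Cell a e) = s a (val s e)"
| "val s (Add d e) = val s d + val s e"
| "val s (Sub d e) = val s d - val s e"
| "val s (Mul d e) = val s d * val s e"

primrec cost :: "expr \<Rightarrow> nat" where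
  "cost (Const k) = 1"
| "cost (Cell a e) = cost e + 1"
| "cost (Add d e) = cost d + cost e + 1"
| "cost (Sub d e) = cost d + cost e + 1"
| "cost (Mul d e) = cost d + cost e + 1"

primrec fits :: "nat \<Rightarrow> store \<Rightarrow> expr \<Rightarrow> bool" where
  "fits b s (Const k) \<longleftrightarrow> k < 2 ^ b"
| "fits b s (Cell a e) \<longleftrightarrow> fits b s e \<and> s a (val s e) < 2 ^ b"
| "fits b s (Add d e) \<longleftrightarrow> fits b s d \<and> fits b s e \<and> val s d + val s e < 2 ^ b"
| "fits b s (Sub d e) \<longleftrightarrow> fits b s d \<and> fits b s e"
| "fits b s (Mul d e) \<longleftrightarrow> fits b s d \<and> fits b s e \<and> val s d * val s e < 2 ^ b"

text \<open>
  \<open>run b c s t s'\<close>: with words of \<open>b\<close> bits, the program \<open>c\<close> started in \<open>s\<close> halts in \<open>s'\<close> after \<open>t\<close>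
  steps. A test succeeds if its value is non-zero.
\<close>

inductive run :: "nat \<Rightarrow> com \<Rightarrow> store \<Rightarrow> nat \<Rightarrow> store \<Rightarrow> bool" for b :: nat where
  run_Skip: "run b Skip s 1 s"
| run_Assign: "fits b s i \<Longrightarrow> fits b s e \<Longrightarrow>
    run b (Assign a i e) s (cost i + cost e + 1) (s(a := (s a)(val s i := val s e)))"
| run_Seq: "run b c s t s' \<Longrightarrow> run b d s' t' s'' \<Longrightarrow> run b (Seq c d) s (t + t') s''"
| run_Cond_true: "fits b s e \<Longrightarrow> val s e \<noteq> 0 \<Longrightarrow> run b c s t s' \<Longrightarrow>
    run b (Cond e c d) s (cost e + 1 + t) s'"
| run_Cond_false: "fits b s e \<Longrightarrow> val s e = 0 \<Longrightarrow> run b d s t s' \<Longrightarrow>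
    run b (Cond e c d) s (cost e + 1 + t) s'"
| run_While_false: "fits b s e \<Longrightarrow> val s e = 0 \<Longrightarrow> run b (While e c) s (cost e + 1) s"
| run_While_true: "fits b s e \<Longrightarrow> val s e \<noteq> 0 \<Longrightarrow> run b c s t s' \<Longrightarrow>
    run b (While e c) s' t' s'' \<Longrightarrow> run b (While e c) s (cost e + 1 + t + t') s''"

section \<open>Input and output of the algorithm\<close>

text \<open>
  The input graph has the vertices \<open>0, \<dots>, n - 1\<close> and is given by its adjacency matrix, stored row
  by row; \<open>Y\<close> is given by its characteristic vector. All other cells are initially zero.
\<close>

definition input_store :: "nat \<Rightarrow> nat pair_pre_digraph \<Rightarrow> nat \<Rightarrow> nat set \<Rightarrow> store" where
  "input_store n G x Y = (\<lambda>_ _. 0)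
     (''n'' := (\<lambda>_. 0)(0 := n),
      ''adj'' := (\<lambda>i. of_bool (i < n * n \<and> (i div n, i mod n) \<in> parcs G)),
      ''x'' := (\<lambda>_. 0)(0 := x),
      ''Y'' := (\<lambda>v. of_bool (v \<in> Y)))"

text \<open>
  Sets of vertices are returned as characteristic vectors and the connected components as a labelling
  that is constant exactly on each component. The answer is \<open>1\<close> for ``generating'' and \<open>0\<close> for
  ``not generating''.
\<close>

definition correct_output ::
    "nat pair_pre_digraph \<Rightarrow> nat set \<Rightarrow> nat set \<Rightarrow> store \<Rightarrow> bool" where
  "correct_output G X Y s \<longleftrightarrow>
     (\<forall>v \<in> pverts G. s ''M1'' v = of_bool (v \<in> M1 G X Y)) \<and>
     (\<forall>v \<in> pverts G. s ''M2'' v = of_bool (v \<in> M2 G X Y)) \<and>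
     (\<forall>u \<in> M2 G X Y. \<forall>v \<in> M2 G X Y.
        s ''component'' u = s ''component'' v \<longleftrightarrow> (\<exists>C \<in> M2_components G X Y. u \<in> C \<and> v \<in> C)) \<and>
     (\<forall>w \<in> M2 G X Y. s ''f'' w = card (M1_nbrs G X Y w)) \<and>
     (\<exists>S. chosen_vertices G X Y S \<and>
        (\<forall>v \<in> pverts G. s ''S'' v = of_bool (v \<in> S)) \<and>
        s ''answer'' 0 = of_bool (dominates_set G S (M1 G X Y)))"

end

theory Submission
  imports Defs
begin

text \<open>
  In a chordal graph two non-adjacent vertices cannot be joined by two walks whose interiors lie in
  disjoint sets without edges between them: shortest such walks would close up to an induced cycle.
  Applied to walks through the star \<open>B\<close> and through a component \<open>C\<close> of \<open>G[M2(B)]\<close>, this shows that the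
  vertices of \<open>M1(B)\<close> with a neighbour in \<open>C\<close> form a clique. Applied once more, it shows that a vertex
  \<open>w\<close> of \<open>C\<close> with \<open>|f(w)|\<close> maximal is adjacent to this whole clique: otherwise follow a path inside \<open>C\<close>
  from \<open>w\<close> to the first vertex \<open>w'\<close> adjacent to a missing \<open>z\<close>; then \<open>f(w')\<close> contains \<open>f(w)\<close> and \<open>z\<close>.
  Hence both \<open>B\<close> being generating and \<open>S\<close> dominating \<open>M1(B)\<close> mean that every vertex of \<open>M1(B)\<close> has a
  neighbour in \<open>M2(B)\<close>.

  For the running time, all steps are loops over pairs of vertices. The components are found in \<open>n\<close>
  rounds of linear cost, each of which completes the neighbourhood of one vertex.
\<close>

section \<open>Distances, induced paths and chordality\<close>

text \<open>\<open>M1\<close> and \<open>M2\<close> are defined separately for the centre and for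
  the leaves of the star. One argument serves both sides because an induced four-cycle is
  impossible: this pushes every vertex of \<open>M2\<close> out of both closed neighbourhoods
  \<open>near_x\<close> and \<open>near_Y\<close>, while \<open>M1\<close> is their symmetric
  difference. The clique property is what gives the inclusion of \<open>f(w)\<close> in
  \<open>f(w')\<close>. It makes \<open>z\<close> adjacent to every \<open>k\<close> in
  \<open>f(w)\<close>, so a \<open>k\<close> not adjacent to \<open>w'\<close> would be joined to
  \<open>w'\<close> both through \<open>z\<close> and along the path that avoids the neighbours of
  \<open>z\<close>. On the machine side the obstacle is that every intermediate value must fit into
  O(log n) bits. A small language of bounded loops, whose assignments are capped at
  \<open>n\<close>, keeps this condition and the step count out of the correctness proofs.\<close>

lemma INF_ereal_eq_iff:
  fixes A :: "nat set"
  shows "(INF a\<in>A. ereal (real a)) = ereal (real k) \<longleftrightarrow> k \<in> A \<and> (\<forall>a\<in>A. k \<le> a)"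
    and "(INF a\<in>A. ereal (real a)) \<le> ereal (real k) \<longleftrightarrow> (\<exists>a\<in>A. a \<le> k)"
proof -
  have "(INF a\<in>A. ereal (real a)) = ereal (real m)" if "m \<in> A" "\<forall>a\<in>A. m \<le> a" for m
    by (rule INF_eqI) (use that in auto)
  moreover have "\<exists>m\<in>A. \<forall>a\<in>A. m \<le> a" if "A \<noteq> {}"
    using that by (intro bexI[of _ "LEAST a. a \<in> A"]) (auto intro: LeastI Least_le)
  \<comment> \<open>Either there is no element and the infimum is infinite, or it is attained
    because the naturals are well-ordered.\<close>
  ultimately have *: "A = {} \<or> (\<exists>m\<in>A. (\<forall>a\<in>A. m \<le> a) \<and> (INF a\<in>A. ereal (real a)) = ereal (real m))"
    by blast
  from * have "((INF a\<in>A. ereal (real a)) = ereal (real k) \<longleftrightarrow> k \<in> A \<and> (\<forall>a\<in>A. k \<le> a)) \<and>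
    ((INF a\<in>A. ereal (real a)) \<le> ereal (real k) \<longleftrightarrow> (\<exists>a\<in>A. a \<le> k))"
  proof
    assume "A = {}"
    then show ?thesis by (simp add: top_ereal_def)
  next
    assume "\<exists>m\<in>A. (\<forall>a\<in>A. m \<le> a) \<and> (INF a\<in>A. ereal (real a)) = ereal (real m)"
    then obtain m where m: "m \<in> A" "\<forall>a\<in>A. m \<le> a"
      and inf: "(INF a\<in>A. ereal (real a)) = ereal (real m)" by blast
    show ?thesis
      unfolding inf using m by (auto intro: order_trans antisym)
  qed
  then show "(INF a\<in>A. ereal (real a)) = ereal (real k) \<longleftrightarrow> k \<in> A \<and> (\<forall>a\<in>A. k \<le> a)"
    and "(INF a\<in>A. ereal (real a)) \<le> ereal (real k) \<longleftrightarrow> (\<exists>a\<in>A. a \<le> k)"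
    by blast+
qed

text \<open>Cuts a path at its first visit to \<open>T\<close>. Requiring every arc to start outside
  \<open>T\<close> records that no earlier vertex lies in \<open>T\<close>.\<close>

lemma rtrancl_first_hit:
  assumes "(u, v) \<in> R\<^sup>*" and "v \<in> T"
  shows "\<exists>w\<in>T. (u, w) \<in> (R \<inter> {(a, b). a \<notin> T})\<^sup>*"
  using assms
proof (induction rule: converse_rtrancl_induct)
  case base
  then show ?case by blast
next
  case (step y z)
  then show ?case
    by (cases "y \<in> T") (auto intro: converse_rtrancl_into_rtrancl)
qed

lemma rtrancl_two_steps: "(a, b) \<in> R \<Longrightarrow> (b, c) \<in> R \<Longrightarrow> (a, c) \<in> R\<^sup>*"
  by (meson r_into_rtrancl rtrancl_into_rtrancl)

section \<open>Distances up to two in terms of arcs\<close>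

context pair_graph
begin

lemma parcs_sym: "(u, v) \<in> parcs G \<Longrightarrow> (v, u) \<in> parcs G"
  using pair_sym_arcs by (auto simp: symmetric_def elim: symE)

lemma parcs_irrefl: "(u, u) \<notin> parcs G"
  using no_loops by fastforce

text \<open>Turns a distance into the infimum of a set of naturals, so that distances up to two only
  ask which of 0, 1 and 2 are lengths of walks.\<close>

definition walk_lengths :: "'a \<Rightarrow> 'a set \<Rightarrow> nat set" where
  "walk_lengths v S = {length p | p s. s \<in> S \<and> awalk v p s}"

lemma set_gdist_conv: "set_gdist G v S = (INF l\<in>walk_lengths v S. ereal (real l))"
proof -
  have cost: "awalk_cost (\<lambda>_. 1) p = length p" for p :: "('a \<times> 'a) awalk"
    by (induction p) auto
  have \<mu>: "wf_digraph.\<mu> (with_proj G) (\<lambda>_. 1) v s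
      = (INF p\<in>{p. awalk v p s}. ereal (awalk_cost (\<lambda>_. 1) p))" for s
    by (subst wf_digraph.\<mu>_def) (auto simp: wf_digraph_axioms)
  show ?thesis
    unfolding set_gdist_def gdist_def \<mu> cost walk_lengths_def
    by (intro antisym INF_greatest) (auto intro!: INF_lower2)
qed

lemma zero_in_walk_lengths: "0 \<in> walk_lengths v S \<longleftrightarrow> v \<in> S \<inter> pverts G"
proof -
  have "0 \<in> walk_lengths v S \<longleftrightarrow> (\<exists>s\<in>S. awalk v [] s)"
    unfolding walk_lengths_def by force
  then show ?thesis
    by (auto simp: awalk_Nil_iff)
qed

lemma one_in_walk_lengths: "1 \<in> walk_lengths v S \<longleftrightarrow> (\<exists>s\<in>S. (v, s) \<in> parcs G)"
proof
  assume "1 \<in> walk_lengths v S"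
  then obtain p s where "s \<in> S" "awalk v p s" "length p = Suc 0"
    unfolding walk_lengths_def by force
  then show "\<exists>s\<in>S. (v, s) \<in> parcs G"
    by (auto simp: length_Suc_conv awalk_simps)
next
  assume "\<exists>s\<in>S. (v, s) \<in> parcs G"
  then obtain s where "s \<in> S" "(v, s) \<in> parcs G" by blast
  then show "1 \<in> walk_lengths v S"
    unfolding walk_lengths_def
    by (intro CollectI exI[of _ "[(v, s)]"] exI[of _ s]) (auto simp: awalk_simps in_arcsD1 in_arcsD2)
qed

lemma two_in_walk_lengths:
  "2 \<in> walk_lengths v S \<longleftrightarrow> (\<exists>s\<in>S. \<exists>u. (v, u) \<in> parcs G \<and> (u, s) \<in> parcs G)"
proof
  assume "2 \<in> walk_lengths v S"
  then obtain p s where "s \<in> S" "awalk v p s" "length p = Suc (Suc 0)"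
    unfolding walk_lengths_def by force
  then show "\<exists>s\<in>S. \<exists>u. (v, u) \<in> parcs G \<and> (u, s) \<in> parcs G"
    by (auto simp: length_Suc_conv awalk_simps) blast
next
  assume "\<exists>s\<in>S. \<exists>u. (v, u) \<in> parcs G \<and> (u, s) \<in> parcs G"
  then obtain s u where "s \<in> S" "(v, u) \<in> parcs G" "(u, s) \<in> parcs G" by blast
  then show "2 \<in> walk_lengths v S"
    unfolding walk_lengths_def
    by (intro CollectI exI[of _ "[(v, u), (u, s)]"] exI[of _ s])
      (auto simp: awalk_simps in_arcsD1 in_arcsD2)
qed

lemma nbhd_one:
  "S \<subseteq> pverts G \<Longrightarrow> nbhd G 1 S = {v. v \<notin> S \<and> (\<exists>s\<in>S. (v, s) \<in> parcs G)}"
proof -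
  assume "S \<subseteq> pverts G"
  have *: "(\<forall>a\<in>A. 1 \<le> a) \<longleftrightarrow> 0 \<notin> A" for A :: "nat set"
    by (metis One_nat_def Suc_leI gr0I not_one_le_zero)
  then show ?thesis
    unfolding nbhd_def set_gdist_conv INF_ereal_eq_iff * one_in_walk_lengths zero_in_walk_lengths
    using \<open>S \<subseteq> pverts G\<close> in_arcsD1 by auto
qed

lemma nbhd_two:
  "S \<subseteq> pverts G \<Longrightarrow> nbhd G 2 S = {v. v \<notin> S \<and> (\<forall>s\<in>S. (v, s) \<notin> parcs G) \<and>
    (\<exists>s\<in>S. \<exists>u. (v, u) \<in> parcs G \<and> (u, s) \<in> parcs G)}"
proof -
  assume "S \<subseteq> pverts G"
  have "2 \<le> a \<longleftrightarrow> a \<noteq> 0 \<and> a \<noteq> 1" for a :: nat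
    by arith
  then have *: "(\<forall>a\<in>A. 2 \<le> a) \<longleftrightarrow> 0 \<notin> A \<and> 1 \<notin> A" for A :: "nat set"
    by metis
  then show ?thesis
    unfolding nbhd_def set_gdist_conv INF_ereal_eq_iff *
      one_in_walk_lengths zero_in_walk_lengths two_in_walk_lengths
    using \<open>S \<subseteq> pverts G\<close> in_arcsD1 by auto
qed

lemma closed_nbhd_one:
  "S \<subseteq> pverts G \<Longrightarrow> closed_nbhd G 1 S = S \<union> {v. \<exists>s\<in>S. (v, s) \<in> parcs G}"
proof -
  assume "S \<subseteq> pverts G"
  have "a \<le> 1 \<longleftrightarrow> a = 0 \<or> a = 1" for a :: nat
    by arith
  then have *: "(\<exists>a\<in>A. a \<le> 1) \<longleftrightarrow> 0 \<in> A \<or> 1 \<in> A" for A :: "nat set"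
    by metis
  then show ?thesis
    unfolding closed_nbhd_def set_gdist_conv INF_ereal_eq_iff *
      one_in_walk_lengths zero_in_walk_lengths
    using \<open>S \<subseteq> pverts G\<close> in_arcsD1 by auto
qed

section \<open>Induced paths and separation in chordal graphs\<close>

text \<open>Lists of vertices rather than of arcs, since a shortcut is then a \<open>take\<close>
  followed by a \<open>drop\<close>.\<close>

definition induced_path :: "'a \<Rightarrow> 'a list \<Rightarrow> 'a \<Rightarrow> bool" where
  "induced_path a c b \<longleftrightarrow> c \<noteq> [] \<and> hd c = a \<and> last c = b \<and> distinct c \<and>
    successively (\<lambda>u v. (u, v) \<in> parcs G) c \<and>
    (\<forall>i j. i + 1 < j \<and> j < length c \<longrightarrow> (c ! i, c ! j) \<notin> parcs G)"

text \<open>A shortest walk with all vertices in \<open>P \<union> {a, b}\<close> is an induced path.\<close>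

lemma induced_path_exists:
  assumes "(a, b) \<in> (parcs G \<inter> (P \<union> {a, b}) \<times> (P \<union> {a, b}))\<^sup>*"
  shows "\<exists>c. induced_path a c b \<and> set c \<subseteq> P \<union> {a, b}"
proof -
  define W where "W c \<longleftrightarrow> c \<noteq> [] \<and> hd c = a \<and> last c = b \<and> set c \<subseteq> P \<union> {a, b} \<and>
    successively (\<lambda>u v. (u, v) \<in> parcs G) c" for c
  have "\<exists>c. c \<noteq> [] \<and> hd c = a \<and> last c = v \<and> set c \<subseteq> P \<union> {a, b} \<and>
    successively (\<lambda>u v. (u, v) \<in> parcs G) c"
    if "(a, v) \<in> (parcs G \<inter> (P \<union> {a, b}) \<times> (P \<union> {a, b}))\<^sup>*" for v
    using that
  proof induction
    case base
    show ?case by (rule exI[of _ "[a]"]) auto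
  next
    case (step y z)
    then obtain c where c: "c \<noteq> []" "hd c = a" "last c = y" "set c \<subseteq> P \<union> {a, b}"
      "successively (\<lambda>u v. (u, v) \<in> parcs G) c" by blast
    then show ?case using step
      by (intro exI[of _ "c @ [z]"]) (auto simp: successively_append_iff)
  qed
  then have "\<exists>c. W c"
    using assms unfolding W_def by blast
  then obtain c where c: "W c" and min: "\<And>d. W d \<Longrightarrow> length c \<le> length d"
    using exists_least_iff[of "\<lambda>l. \<exists>c. W c \<and> length c = l"] by (metis linorder_not_less)
  have succ: "successively (\<lambda>u v. (u, v) \<in> parcs G) (take i c)"
    "successively (\<lambda>u v. (u, v) \<in> parcs G) (drop i c)" for i
    using c unfolding W_def by (metis append_take_drop_id successively_append_iff)+
  have sub: "set (take i c) \<subseteq> P \<union> {a, b}" "set (drop i c) \<subseteq> P \<union> {a, b}" for i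
    using c set_take_subset[of i c] set_drop_subset[of i c] unfolding W_def by blast+
  have last_drop: "last (drop j c) = b" if "j < length c" for j
    using c that by (simp add: W_def)
  \<comment> \<open>A chord from position \<open>i\<close> to position \<open>j\<close> would let
    the walk skip everything strictly between them.\<close>
  have "(c ! i, c ! j) \<notin> parcs G" if "i + 1 < j" "j < length c" for i j
  proof
    assume "(c ! i, c ! j) \<in> parcs G"
    moreover have "last (take (i + 1) c) = c ! i"
      using that by (simp add: take_Suc_conv_app_nth)
    moreover have "hd (drop j c) = c ! j"
      using that by (simp add: hd_drop_conv_nth)
    moreover have "hd (take (i + 1) c) = a"
      using c by (simp add: W_def)
    ultimately have "W (take (i + 1) c @ drop j c)"
      using that succ sub[of j] sub[of "i+1"] last_drop c
      by (auto simp: W_def successively_append_iff hd_append)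
    from min[OF this] that show False by simp
  qed
  moreover have "c ! i \<noteq> c ! j" if "i < j" "j < length c" for i j
  proof
    assume eq: "c ! i = c ! j"
    have hd_drop: "hd (drop j c) = c ! j"
      using that by (simp add: hd_drop_conv_nth)
    \<comment> \<open>For \<open>i = 0\<close> the prefix is empty and the walk starts at
      \<open>c ! j = a\<close>; otherwise the arc into \<open>c ! i\<close> serves as the arc into
      \<open>c ! j\<close>.\<close>
    have "W (take i c @ drop j c)"
    proof (cases "i = 0")
      case True
      then show ?thesis
        using that succ sub[of j] last_drop c eq hd_drop by (auto simp: W_def hd_conv_nth)
    next
      case False
      then obtain i' where i': "i = Suc i'" by (cases i) auto
      have "last (take i c) = c ! i'"
        using that by (simp add: i' take_Suc_conv_app_nth)
      moreover have "(c ! i', c ! i) \<in> parcs G"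
        using c that i' by (auto simp: W_def successively_conv_nth)
      moreover have "hd (take i c) = a"
        using c i' by (simp add: W_def)
      ultimately show ?thesis
        using that succ sub[of j] sub[of i] last_drop c eq hd_drop False
        by (auto simp: W_def successively_append_iff hd_append)
    qed
    from min[OF this] that show False by simp
  qed
  then have "distinct c"
    unfolding distinct_conv_nth by (metis linorder_neqE_nat)
  ultimately show ?thesis
    using c unfolding W_def induced_path_def by blast
qed

lemma pcas_zip:
  "pcas (hd c) (zip c (tl c)) (last c)" if "c \<noteq> []"
  using that by (induction c rule: induct_list012) auto

lemma pcas_append: "pcas u p v \<Longrightarrow> pcas v q w \<Longrightarrow> pcas u (p @ q) w"
  by (induction p arbitrary: u) auto

lemma set_zip_tl_subset:
  "successively (\<lambda>u v. (u, v) \<in> parcs G) c \<Longrightarrow> set (zip c (tl c)) \<subseteq> parcs G"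
  by (induction c rule: induct_list012) auto

text \<open>Both paths are taken induced, so a chord of the cycle they form could only run between
  their interiors, which lie in \<open>P\<close> and in \<open>Q\<close>. As \<open>a\<close> and
  \<open>b\<close> are not adjacent, each path has an interior vertex, so the cycle has length at
  least four.\<close>

lemma chordal_separation:
  assumes "chordal G" and "a \<noteq> b" and "(a, b) \<notin> parcs G"
    and P: "(a, b) \<in> (parcs G \<inter> (P \<union> {a, b}) \<times> (P \<union> {a, b}))\<^sup>*"
    and Q: "(b, a) \<in> (parcs G \<inter> (Q \<union> {a, b}) \<times> (Q \<union> {a, b}))\<^sup>*"
    and "P \<inter> Q = {}" and "\<And>p q. p \<in> P \<Longrightarrow> q \<in> Q \<Longrightarrow> (p, q) \<notin> parcs G"
  shows False
proof -
  obtain c where c: "c \<noteq> []" "hd c = a" "last c = b" "set c \<subseteq> P \<union> {a, b}"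
    "successively (\<lambda>u v. (u, v) \<in> parcs G) c" "distinct c"
    and ci: "\<forall>i j. i + 1 < j \<and> j < length c \<longrightarrow> (c ! i, c ! j) \<notin> parcs G"
    using induced_path_exists[OF P] unfolding induced_path_def by blast
  have "(b, a) \<in> (parcs G \<inter> (Q \<union> {b, a}) \<times> (Q \<union> {b, a}))\<^sup>*"
    using Q by (simp add: insert_commute)
  from induced_path_exists[OF this]
  obtain d where d: "d \<noteq> []" "hd d = b" "last d = a" "set d \<subseteq> Q \<union> {b, a}"
    "successively (\<lambda>u v. (u, v) \<in> parcs G) d" "distinct d"
    and di: "\<forall>i j. i + 1 < j \<and> j < length d \<longrightarrow> (d ! i, d ! j) \<notin> parcs G"
    unfolding induced_path_def by blast
  have shape: "\<exists>ps. e = u # ps @ [v] \<and> ps \<noteq> []"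
    if e: "e \<noteq> []" "hd e = u" "last e = v" "u \<noteq> v" "(u, v) \<notin> parcs G"
      "successively (\<lambda>u v. (u, v) \<in> parcs G) e" for e u v
  proof -
    obtain e' where "e = u # e'" "e' \<noteq> []"
      using e(1-4) by (metis last.simps list.collapse)
    moreover from this obtain ps w where "e' = ps @ [w]"
      by (metis rev_exhaust)
    ultimately show ?thesis
      using e by auto
  qed
  obtain ps where ps: "c = a # ps @ [b]" "ps \<noteq> []"
    using shape[of c a b] c assms by blast
  obtain qs where qs: "d = b # qs @ [a]" "qs \<noteq> []"
    using shape[of d b a] d assms parcs_sym by blast
  have psP: "set ps \<subseteq> P" and qsQ: "set qs \<subseteq> Q"
    using c(4,6) d(4,6) ps qs by auto
  define p where "p = zip c (tl c) @ zip d (tl d)"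
  \<comment> \<open>The arcs of a path are \<open>zip e (tl e)\<close>. Their sources miss only the
    last vertex, which is the first vertex of the other path, so together the sources are all
    vertices of the cycle.\<close>
  have tails: "map fst (zip e (tl e)) = butlast e" and heads: "map snd (zip e (tl e)) = tl e"
    for e :: "'a list"
    by (induction e rule: induct_list012) auto
  have setp: "set p \<subseteq> parcs G"
    unfolding p_def using set_zip_tl_subset c(5) d(5) by auto
  have cV: "set c \<subseteq> pverts G"
  proof
    fix v assume "v \<in> set c"
    then have "v \<in> set (butlast c) \<union> set (butlast d)"
      using ps qs by (auto simp: butlast_append)
    then have "v \<in> fst ` set p"
      unfolding p_def by (metis Un_iff image_Un set_append set_map tails)
    then show "v \<in> pverts G"
      using setp arc_fst_in_verts by blast
  qed
  have "awalk a p a"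
  proof -
    have "pcas a (zip c (tl c)) b" "pcas b (zip d (tl d)) a"
      using pcas_zip[OF c(1)] pcas_zip[OF d(1)] unfolding c(2,3) d(2,3) .
    then have "pcas a p a"
      unfolding p_def by (rule pcas_append)
    then show ?thesis
      unfolding awalk_def using setp cV ps by auto
  qed
  moreover have "tl (pawalk_verts a p) = tl c @ tl d"
  proof -
    have "p \<noteq> []" using ps by (auto simp: p_def)
    then have "tl (pawalk_verts a p) = map snd p"
      using awalk_verts_conv'[of a p a] \<open>awalk a p a\<close> unfolding awalk_def by auto
    then show ?thesis
      by (simp add: p_def heads)
  qed
  moreover have "distinct (tl c @ tl d)"
    using c(6) d(6) ps qs psP qsQ assms(6) by auto
  moreover have len: "length p \<ge> 4"
    using ps qs by (cases ps; cases qs) (auto simp: p_def)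
  ultimately have "cycle p"
    unfolding cycle_def by auto
  have "fst ` set p = set c \<union> set d"
  proof -
    have "fst ` set p = set (butlast c) \<union> set (butlast d)"
      unfolding p_def by (metis image_Un set_append set_map tails)
    also have "\<dots> = set c \<union> set d"
      using ps qs by (auto simp: butlast_append)
    finally show ?thesis .
  qed
  \<comment> \<open>Adjacent vertices of an induced path occupy consecutive positions.\<close>
  have chord: "(u, v) \<in> set (zip e (tl e)) \<union> (set (zip e (tl e)))\<inverse>"
    if e: "u \<in> set e" "v \<in> set e" "(u, v) \<in> parcs G"
      "\<forall>i j. i + 1 < j \<and> j < length e \<longrightarrow> (e ! i, e ! j) \<notin> parcs G" for e u v
  proof -
    obtain i j where ij: "i < length e" "j < length e" "u = e ! i" "v = e ! j"
      using e(1,2) by (metis in_set_conv_nth)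
    have "\<not> i + 1 < j" "\<not> j + 1 < i" "i \<noteq> j"
      using e ij parcs_sym parcs_irrefl by blast+
    then have "j = Suc i \<or> i = Suc j"
      by linarith
    then show ?thesis
      using ij by (force simp: set_zip nth_tl)
  qed
  have "arcs (with_proj G \<restriction> (fst ` set p)) \<subseteq> set p \<union> (set p)\<inverse>"
  proof
    fix e assume "e \<in> arcs (with_proj G \<restriction> (fst ` set p))"
    then obtain u v where e: "e = (u, v)" "(u, v) \<in> parcs G" "u \<in> set c \<union> set d" "v \<in> set c \<union> set d"
      unfolding \<open>fst ` set p = set c \<union> set d\<close> by (cases e) auto
    have cross: "(p, q) \<notin> parcs G \<and> (q, p) \<notin> parcs G" if "p \<in> set ps" "q \<in> set qs" for p q
      using that assms(7) psP qsQ parcs_sym by blast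
    \<comment> \<open>The ends \<open>a\<close> and \<open>b\<close> belong to both paths, so only
      two interior vertices could fail to share a path, and \<open>cross\<close> excludes
      that.\<close>
    have "u \<in> set c \<and> v \<in> set c \<or> u \<in> set d \<and> v \<in> set d"
      using e(2-4) cross unfolding ps(1) qs(1) by auto
    then show "e \<in> set p \<union> (set p)\<inverse>"
      using chord[OF _ _ e(2) ci] chord[OF _ _ e(2) di] unfolding p_def e(1) by auto
  qed
  then have "induced_cycle G p"
    unfolding induced_cycle_def using \<open>cycle p\<close> len by simp
  then show False
    using \<open>chordal G\<close> len unfolding chordal_def by force
qed

end

section \<open>Generating stars in chordal graphs\<close>

locale chordal_star = pair_graph G for G :: "'a pair_pre_digraph" +
  fixes x :: 'a and Y :: "'a set"
  assumes chordal: "chordal G" and star: "induced_complete_bipartite G {x} Y"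
begin

abbreviation M1s :: "'a set" where "M1s \<equiv> M1 G {x} Y"
abbreviation M2s :: "'a set" where "M2s \<equiv> M2 G {x} Y"
abbreviation f :: "'a \<Rightarrow> 'a set" where "f \<equiv> M1_nbrs G {x} Y"

section \<open>The sets \<open>M1\<close> and \<open>M2\<close> of a star\<close>

definition near_x :: "'a set" where "near_x = {v. v = x \<or> (v, x) \<in> parcs G}"
definition near_Y :: "'a set" where "near_Y = {v. v \<in> Y \<or> (\<exists>y\<in>Y. (v, y) \<in> parcs G)}"

lemma star_verts: "x \<in> pverts G" "Y \<subseteq> pverts G" "Y \<noteq> {}" "x \<notin> Y"
  using star unfolding induced_complete_bipartite_def by auto

lemma star_arcs:
  "y \<in> Y \<Longrightarrow> (x, y) \<in> parcs G" "y \<in> Y \<Longrightarrow> (y, x) \<in> parcs G"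
  "y \<in> Y \<Longrightarrow> y' \<in> Y \<Longrightarrow> (y, y') \<notin> parcs G"
proof -
  have *: "{e \<in> parcs G. fst e \<in> {x} \<union> Y \<and> snd e \<in> {x} \<union> Y} = {x} \<times> Y \<union> Y \<times> {x}"
    using star unfolding induced_complete_bipartite_def by simp
  have "e \<in> parcs G" if "e \<in> {x} \<times> Y \<union> Y \<times> {x}" for e
    using that unfolding *[symmetric] by blast
  then show "y \<in> Y \<Longrightarrow> (x, y) \<in> parcs G" "y \<in> Y \<Longrightarrow> (y, x) \<in> parcs G"
    by blast+
  show "(y, y') \<notin> parcs G" if "y \<in> Y" "y' \<in> Y"
  proof
    assume "(y, y') \<in> parcs G"
    then have "(y, y') \<in> {x} \<times> Y \<union> Y \<times> {x}"
      using that unfolding *[symmetric] by simp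
    then show False
      using that star_verts(4) by auto
  qed
qed

lemma nbhd_2_singleton:
  "nbhd G 2 {x} = {v. v \<notin> near_x \<and> (\<exists>u. (v, u) \<in> parcs G \<and> (u, x) \<in> parcs G)}"
  using star_verts(1) by (subst nbhd_two) (auto simp: near_x_def)

lemma nbhd_2_leaves:
  "nbhd G 2 Y = {v. v \<notin> near_Y \<and> (\<exists>y\<in>Y. \<exists>u. (v, u) \<in> parcs G \<and> (u, y) \<in> parcs G)}"
  using star_verts(2) by (subst nbhd_two) (auto simp: near_Y_def)

text \<open>A neighbour of \<open>x\<close> reaches \<open>Y\<close> through \<open>x\<close> in two
  steps, so membership in \<open>N_2(Y)\<close> only says that it is outside \<open>near_Y\<close>.
  For the leaves the roles are exchanged.\<close>

lemma M1_of_centre: "M1_of G Y {x} = near_x - near_Y"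
  unfolding M1_of_def nbhd_2_leaves using star_verts star_arcs
  by (subst nbhd_one) (auto simp: near_x_def near_Y_def)

lemma M1_of_leaves: "M1_of G {x} Y = near_Y - near_x"
  unfolding M1_of_def nbhd_2_singleton using star_verts star_arcs
  by (subst nbhd_one) (auto simp: near_x_def near_Y_def)

lemma M1_eq: "M1s = (near_x - near_Y) \<union> (near_Y - near_x)"
  unfolding M1_def M1_of_centre M1_of_leaves by blast

lemma near_subset: "near_x \<subseteq> pverts G" "near_Y \<subseteq> pverts G"
  using star_verts in_arcsD1 by (auto simp: near_x_def near_Y_def)

lemma M1_subset: "M1s \<subseteq> pverts G"
  unfolding M1_eq using near_subset by blast

text \<open>The smallest case of separation, with one vertex on each side.\<close>

lemma no_four_cycle:
  assumes "(a, p) \<in> parcs G" "(p, b) \<in> parcs G" "(a, q) \<in> parcs G" "(q, b) \<in> parcs G"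
    "a \<noteq> b" "(a, b) \<notin> parcs G" "p \<noteq> q" "(p, q) \<notin> parcs G"
  shows False
proof (rule chordal_separation[OF chordal assms(5,6), of "{p}" "{q}"])
  show "(a, b) \<in> (parcs G \<inter> ({p} \<union> {a, b}) \<times> ({p} \<union> {a, b}))\<^sup>*"
    using assms by (intro rtrancl_two_steps[of a p]) auto
  show "(b, a) \<in> (parcs G \<inter> ({q} \<union> {a, b}) \<times> ({q} \<union> {a, b}))\<^sup>*"
    using assms parcs_sym by (intro rtrancl_two_steps[of b q]) auto
qed (use assms in auto)

text \<open>The definition only keeps \<open>w\<close> away from \<open>x\<close>. Chordality also
  keeps it away from \<open>Y\<close>: an arc from \<open>w\<close> to a leaf \<open>y\<close> would
  close the induced four-cycle \<open>w, z, x, y\<close>.\<close>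

lemma M2_of_centre:
  "M2_of G Y {x} {x} = {w. w \<notin> near_x \<union> near_Y \<and> (\<exists>z\<in>near_x - near_Y. (w, z) \<in> parcs G)}"
proof -
  have "w \<notin> near_Y" if w: "w \<notin> near_x" and z: "z \<in> near_x" "z \<notin> near_Y" "(w, z) \<in> parcs G" for w z
  proof
    assume "w \<in> near_Y"
    moreover have "(z, x) \<in> parcs G" "z \<noteq> x"
      using z star_verts(3) star_arcs by (auto simp: near_x_def near_Y_def)
    moreover have "w \<notin> Y"
      using z parcs_sym by (auto simp: near_Y_def)
    ultimately obtain y where "y \<in> Y" "(w, y) \<in> parcs G"
      by (auto simp: near_Y_def)
    then show False
      using no_four_cycle[of w z x y] w z star_arcs \<open>(z, x) \<in> parcs G\<close>
      by (auto simp: near_x_def near_Y_def)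
  qed
  moreover have "nbhd G 1 (near_x - near_Y) = {w. w \<notin> near_x - near_Y \<and> (\<exists>z\<in>near_x - near_Y. (w, z) \<in> parcs G)}"
    using near_subset by (intro nbhd_one) blast
  moreover have "(z, x) \<in> parcs G" if "z \<in> near_x - near_Y" for z
    using that star_verts(3) star_arcs(1) by (auto simp: near_x_def near_Y_def)
  ultimately show ?thesis
    unfolding M2_of_def M1_of_centre nbhd_2_singleton by blast
qed

text \<open>Mirror image of the centre case: with \<open>y\<close> a leaf next to \<open>z\<close>,
  a \<open>w\<close> adjacent to \<open>x\<close> would close the induced four-cycle
  \<open>w, z, y, x\<close>.\<close>

lemma M2_of_leaves:
  "M2_of G {x} Y Y = {w. w \<notin> near_x \<union> near_Y \<and> (\<exists>z\<in>near_Y - near_x. (w, z) \<in> parcs G)}"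
proof -
  have nbr: "\<exists>y\<in>Y. (z, y) \<in> parcs G" if "z \<in> near_Y - near_x" for z
    using that star_arcs(2) by (auto simp: near_x_def near_Y_def)
  have "w \<notin> near_x" if w: "w \<notin> near_Y" and z: "z \<in> near_Y" "z \<notin> near_x" "(w, z) \<in> parcs G" for w z
  proof
    assume "w \<in> near_x"
    moreover obtain y where "y \<in> Y" "(z, y) \<in> parcs G"
      using nbr z by blast
    moreover have "w \<noteq> x"
      using z parcs_sym by (auto simp: near_x_def)
    ultimately show False
      using no_four_cycle[of w z y x] w z star_arcs
      by (auto simp: near_x_def near_Y_def)
  qed
  moreover have "nbhd G 1 (near_Y - near_x) = {w. w \<notin> near_Y - near_x \<and> (\<exists>z\<in>near_Y - near_x. (w, z) \<in> parcs G)}"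
    using near_subset by (intro nbhd_one) blast
  ultimately show ?thesis
    unfolding M2_of_def M1_of_leaves nbhd_2_leaves using nbr by blast
qed

text \<open>The two descriptions differ only in the half of \<open>M1\<close> that contains
  \<open>z\<close>, so their union is uniform and the sides need not be told apart any more.\<close>

lemma M2_eq: "M2s = {w. w \<notin> near_x \<union> near_Y \<and> (\<exists>z\<in>M1s. (w, z) \<in> parcs G)}"
  unfolding M2_def M2_of_centre M2_of_leaves M1_eq by blast

lemma M2_subset: "M2s \<subseteq> pverts G"
  unfolding M2_eq using in_arcsD1 by blast

lemma M1_M2_disjoint: "M1s \<inter> M2s = {}"
  unfolding M1_eq M2_eq by blast

lemma f_eq: "f w = {z \<in> M1s. (w, z) \<in> parcs G}" if "w \<in> pverts G"
  unfolding M1_nbrs_def using that parcs_sym parcs_irrefl by (subst nbhd_one) auto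

lemma finite_f: "finite (f w)"
  unfolding M1_nbrs_def using finite_subset[OF M1_subset pair_finite_verts] by simp

section \<open>Components of the graph induced by \<open>M2\<close>\<close>

definition link :: "'a rel" where
  "link = parcs G \<inter> M2s \<times> M2s"

lemma link_sym: "(u, v) \<in> link\<^sup>* \<Longrightarrow> (v, u) \<in> link\<^sup>*"
  using sym_rtrancl[of link] parcs_sym by (auto simp: link_def sym_def)

lemma link_closed: "(u, v) \<in> link\<^sup>* \<Longrightarrow> u \<in> M2s \<Longrightarrow> v \<in> M2s"
  by (induction rule: rtrancl_induct) (auto simp: link_def)

text \<open>\<open>link\<close> is symmetric, so mutual reachability is reachability and the strong
  components are the classes of its reflexive transitive closure.\<close>

lemma M2_components_eq: "M2_components G {x} Y = (\<lambda>u. {v. (u, v) \<in> link\<^sup>*}) ` M2s"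
proof -
  let ?H = "with_proj G \<restriction> M2s"
  interpret H: wf_digraph ?H
    by (rule wellformed_induce_subgraph)
  have ends: "arcs_ends ?H = link"
    by (auto simp: arcs_ends_def arc_to_ends_def link_def image_iff)
  have reach: "reachable ?H u v \<longleftrightarrow> (u, v) \<in> link\<^sup>*" if "u \<in> M2s" for u v
  proof
    show "reachable ?H u v \<Longrightarrow> (u, v) \<in> link\<^sup>*"
      unfolding reachable_def ends by (rule rtrancl_on_rtranclI)
    show "reachable ?H u v" if "(u, v) \<in> link\<^sup>*"
      using that
    proof induction
      case base
      show ?case using \<open>u \<in> M2s\<close> by (simp add: reachable_def)
    next
      case (step v w)
      then show ?case
        unfolding reachable_def ends by (auto intro: rtrancl_on_into_rtrancl_on simp: link_def)
    qed
  qed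
  have "H.scc_of u = {v. (u, v) \<in> link\<^sup>*}" if "u \<in> M2s" for u
    unfolding H.scc_of_def
    using reach[OF that] reach link_closed that link_sym by blast
  then show ?thesis
    unfolding M2_components_def H.sccs_verts_conv_scc_of by auto
qed

lemma component_subset: "C \<in> M2_components G {x} Y \<Longrightarrow> C \<subseteq> M2s"
  unfolding M2_components_eq using link_closed by blast

lemma component_link:
  assumes "C \<in> M2_components G {x} Y" "u \<in> C"
  shows "C = {v. (u, v) \<in> link\<^sup>*}"
proof -
  obtain c where C: "C = {v. (c, v) \<in> link\<^sup>*}"
    using assms(1) unfolding M2_components_eq by blast
  then have "(c, u) \<in> link\<^sup>*" "(u, c) \<in> link\<^sup>*"
    using assms(2) link_sym by auto
  then show ?thesis
    unfolding C by (auto intro: rtrancl_trans)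
qed

lemma component_exists: "u \<in> M2s \<Longrightarrow> \<exists>C\<in>M2_components G {x} Y. u \<in> C"
  unfolding M2_components_eq by blast

lemma same_component_iff:
  "u \<in> M2s \<Longrightarrow> (\<exists>C\<in>M2_components G {x} Y. u \<in> C \<and> v \<in> C) \<longleftrightarrow> (u, v) \<in> link\<^sup>*"
  using component_link[of _ u] component_exists[of u] by auto

lemma component_connected:
  assumes "C \<in> M2_components G {x} Y" "u \<in> C" "v \<in> C"
  shows "(u, v) \<in> (parcs G \<inter> C \<times> C)\<^sup>*"
proof -
  have "(u, v) \<in> link\<^sup>*"
    using component_link[OF assms(1,2)] assms(3) by blast
  then show ?thesis
  proof induction
    case (step v w)
    then have "v \<in> C" "w \<in> C"
      using component_link[OF assms(1,2)] by (auto intro: rtrancl_into_rtrancl)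
    then show ?case
      using step by (auto simp: link_def intro: rtrancl_into_rtrancl)
  qed simp
qed

section \<open>Neighbours in \<open>M1\<close> of a component\<close>

lemma component_M1_clique:
  assumes C: "C \<in> M2_components G {x} Y" and z: "z \<in> M1s" "z' \<in> M1s" "z \<noteq> z'"
    and c: "c \<in> C" "(z, c) \<in> parcs G" "c' \<in> C" "(z', c') \<in> parcs G"
  shows "(z, z') \<in> parcs G"
proof (rule ccontr)
  assume nonadj: "(z, z') \<notin> parcs G"
  let ?P = "{x} \<union> Y"
  let ?RP = "parcs G \<inter> (?P \<union> {z, z'}) \<times> (?P \<union> {z, z'})"
  let ?RC = "parcs G \<inter> (C \<union> {z, z'}) \<times> (C \<union> {z, z'})"
  have far: "(p, q) \<notin> parcs G" if "p \<in> ?P" "q \<in> C" for p q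
    using that component_subset[OF C] parcs_sym unfolding M2_eq near_x_def near_Y_def by blast
  have nbr: "\<exists>p\<in>?P. (z, p) \<in> parcs G" if "z \<in> M1s" for z
    using that star_verts(3) star_arcs unfolding M1_eq near_x_def near_Y_def by blast
  obtain p where p: "p \<in> ?P" "(z, p) \<in> parcs G" using nbr z by blast
  obtain p' where p': "p' \<in> ?P" "(z', p') \<in> parcs G" using nbr z by blast
  \<comment> \<open>Each of \<open>p\<close> and \<open>p'\<close> is \<open>x\<close> or a leaf, so
    \<open>x\<close> connects them inside the star.\<close>
  have "(p, x) \<in> ?RP\<^sup>*" "(x, p') \<in> ?RP\<^sup>*"
    using p p' star_arcs by auto
  moreover have "(z, p) \<in> ?RP" "(p', z') \<in> ?RP"
    using p p' parcs_sym by auto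
  ultimately have 1: "(z, z') \<in> ?RP\<^sup>*"
    by (meson converse_rtrancl_into_rtrancl rtrancl_into_rtrancl rtrancl_trans)
  have "(c', c) \<in> ?RC\<^sup>*"
    using component_connected[OF C c(3,1)] by (rule rtrancl_mono[THEN subsetD, rotated]) auto
  moreover have "(z', c') \<in> ?RC" "(c, z) \<in> ?RC"
    using c parcs_sym by auto
  ultimately have 2: "(z', z) \<in> ?RC\<^sup>*"
    by (meson converse_rtrancl_into_rtrancl rtrancl_into_rtrancl rtrancl_trans)
  have "?P \<inter> C = {}"
    using component_subset[OF C] unfolding M2_eq near_x_def near_Y_def by blast
  then show False
    using chordal_separation[OF chordal z(3) nonadj 1 2] far by blast
qed

lemma component_max_complete:
  assumes C: "C \<in> M2_components G {x} Y" and w: "w \<in> C"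
    and max: "\<And>v. v \<in> C \<Longrightarrow> card (f v) \<le> card (f w)"
    and z: "z \<in> M1s" and c: "c \<in> C" "(z, c) \<in> parcs G"
  shows "(w, z) \<in> parcs G"
proof (rule ccontr)
  assume nonadj: "(w, z) \<notin> parcs G"
  let ?R = "parcs G \<inter> C \<times> C"
  let ?N = "{v \<in> C. (v, z) \<in> parcs G}"
  have "(w, c) \<in> ?R\<^sup>*"
    by (rule component_connected[OF C w c(1)])
  moreover have "c \<in> ?N"
    using c parcs_sym by auto
  ultimately obtain w' where w': "w' \<in> ?N" "(w, w') \<in> (?R \<inter> {(a, b). a \<notin> ?N})\<^sup>*"
    using rtrancl_first_hit[of w c ?R ?N] by blast
  have CM2: "C \<subseteq> M2s" using component_subset[OF C] .
  have V: "w \<in> pverts G" "w' \<in> pverts G"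
    using w w' CM2 M2_subset by auto
  \<comment> \<open>The separating pair is \<open>k\<close> and \<open>w'\<close>: one side is
    \<open>z\<close> alone, the other is the part \<open>?Q\<close> of the component without
    neighbours of \<open>z\<close>.\<close>
  have "(k, w') \<in> parcs G" if k: "k \<in> f w" for k
  proof (rule ccontr)
    assume k': "(k, w') \<notin> parcs G"
    let ?Q = "C - ?N"
    have kw: "k \<in> M1s" "(w, k) \<in> parcs G"
      using k f_eq V by auto
    have "k \<noteq> z"
      using kw nonadj by auto
    then have kz: "(k, z) \<in> parcs G"
      using component_M1_clique[OF C kw(1) z _ w _ c] kw parcs_sym by blast
    have ne: "k \<noteq> w'"
      using kw w' CM2 M1_M2_disjoint by blast
    have "(k, w') \<in> (parcs G \<inter> ({z} \<union> {k, w'}) \<times> ({z} \<union> {k, w'}))\<^sup>*"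
      using kz w' parcs_sym by (intro rtrancl_two_steps[of k z]) auto
    moreover have "(w', k) \<in> (parcs G \<inter> (?Q \<union> {k, w'}) \<times> (?Q \<union> {k, w'}))\<^sup>*"
    proof -
      let ?S = "parcs G \<inter> (?Q \<union> {k, w'}) \<times> (?Q \<union> {k, w'})"
      have "sym ?S"
        using parcs_sym by (auto simp: sym_def)
      then have "sym (?S\<^sup>*)"
        by (rule sym_rtrancl)
      \<comment> \<open>Backwards along the path: each of its arcs starts outside \<open>?N\<close>,
        so every vertex before \<open>w'\<close> lies in \<open>?Q\<close>.\<close>
      have "(u, w') \<in> ?S\<^sup>* \<and> u \<in> ?Q \<union> {w'}" if "(u, w') \<in> (?R \<inter> {(a, b). a \<notin> ?N})\<^sup>*" for u
        using that
      proof (induction rule: converse_rtrancl_induct)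
        case (step u v)
        then have "(u, v) \<in> ?S" "u \<in> ?Q" by auto
        then show ?case
          using step by (auto intro: converse_rtrancl_into_rtrancl)
      qed simp
      then have "(w, w') \<in> ?S\<^sup>*" "w \<in> ?Q \<union> {w'}"
        using w'(2) by blast+
      moreover have "(k, w) \<in> ?S"
        using kw parcs_sym calculation(2) by auto
      ultimately have "(k, w') \<in> ?S\<^sup>*"
        by (auto intro: converse_rtrancl_into_rtrancl)
      then show ?thesis
        using \<open>sym (?S\<^sup>*)\<close> by (auto elim: symE)
    qed
    moreover have "z \<notin> C"
      using z CM2 M1_M2_disjoint by blast
    ultimately show False
      using chordal_separation[OF chordal ne k', of "{z}" ?Q] parcs_sym by blast
  qed
  then have "insert z (f w) \<subseteq> f w'"
    using f_eq V z w' parcs_sym by auto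
  then have "card (insert z (f w)) \<le> card (f w')"
    by (intro card_mono finite_f)
  moreover have "z \<notin> f w"
    using f_eq V nonadj by auto
  ultimately have "card (f w) < card (f w')"
    using finite_f by simp
  then show False
    using max[of w'] w' by force
qed

lemma finite_component: "C \<in> M2_components G {x} Y \<Longrightarrow> finite C"
  using component_subset M2_subset pair_finite_verts finite_subset by metis

text \<open>An arc between two chosen vertices would put them into the same component, which has
  only one. The chosen vertex of the component of \<open>w\<close> can stand in for
  \<open>w\<close>, since \<open>component_max_complete\<close> makes it adjacent to every vertex of
  \<open>M1\<close> with a neighbour there.\<close>

lemma chosen_vertices_complete:
  assumes S: "chosen_vertices G {x} Y S"
  shows "S \<subseteq> M2s" and "independent_set G S"
    and "w \<in> M2s \<Longrightarrow> z \<in> M1s \<Longrightarrow> (w, z) \<in> parcs G \<Longrightarrow> \<exists>s\<in>S. (s, z) \<in> parcs G"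
proof -
  obtain g where g: "\<And>C. C \<in> M2_components G {x} Y \<Longrightarrow> g C \<in> C"
      "\<And>C. C \<in> M2_components G {x} Y \<Longrightarrow> card (f (g C)) = Max ((\<lambda>v. card (f v)) ` C)"
    and Sg: "S = g ` M2_components G {x} Y"
    using S unfolding chosen_vertices_def by blast
  show "S \<subseteq> M2s"
    using g(1) component_subset unfolding Sg by blast
  have "(g C, g D) \<notin> parcs G" if CD: "C \<in> M2_components G {x} Y" "D \<in> M2_components G {x} Y" for C D
  proof
    assume adj: "(g C, g D) \<in> parcs G"
    then have "(g C, g D) \<in> link"
      using g(1) component_subset CD unfolding link_def by blast
    then have "g D \<in> C"
      using component_link[OF CD(1) g(1)[OF CD(1)]] by blast
    then have "C = D"
      using component_link CD g(1) by metis
    then show False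
      using adj parcs_irrefl by blast
  qed
  then show "independent_set G S"
    unfolding independent_set_def using \<open>S \<subseteq> M2s\<close> M2_subset unfolding Sg by blast
  show "\<exists>s\<in>S. (s, z) \<in> parcs G" if w: "w \<in> M2s" "z \<in> M1s" "(w, z) \<in> parcs G"
  proof -
    obtain C where C: "C \<in> M2_components G {x} Y" "w \<in> C"
      using component_exists w by blast
    have "card (f v) \<le> card (f (g C))" if "v \<in> C" for v
      using g(2)[OF C(1)] finite_component[OF C(1)] that by simp
    then have "(g C, z) \<in> parcs G"
      using component_max_complete[OF C(1) g(1)[OF C(1)] _ w(2) C(2)] w(3) parcs_sym by blast
    then show ?thesis
      unfolding Sg using C(1) by blast
  qed
qed

text \<open>\<open>S\<close> lies in \<open>M2\<close>, hence off \<open>M1\<close>, so domination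
  means adjacency. The second form is independent of the choice of \<open>S\<close>.\<close>

lemma dominates_M1_iff:
  assumes "chosen_vertices G {x} Y S"
  shows "dominates_set G S M1s \<longleftrightarrow> (\<forall>z\<in>M1s. \<exists>s\<in>S. (z, s) \<in> parcs G)"
    and "dominates_set G S M1s \<longleftrightarrow> (\<forall>z\<in>M1s. \<exists>w\<in>M2s. (z, w) \<in> parcs G)"
proof -
  note chosen_vertices_complete[OF assms]
  then show 1: "dominates_set G S M1s \<longleftrightarrow> (\<forall>z\<in>M1s. \<exists>s\<in>S. (z, s) \<in> parcs G)"
    unfolding dominates_set_def using M1_M2_disjoint M2_subset by (subst closed_nbhd_one) blast+
  show "dominates_set G S M1s \<longleftrightarrow> (\<forall>z\<in>M1s. \<exists>w\<in>M2s. (z, w) \<in> parcs G)"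
    unfolding 1 using chosen_vertices_complete[OF assms] parcs_sym by (meson subsetD)
qed

section \<open>Generating means that \<open>M2\<close> dominates \<open>M1\<close>\<close>

lemma maximal_independent_set_iff:
  "maximal_independent_set G S \<longleftrightarrow>
    independent_set G S \<and> (\<forall>v\<in>pverts G - S. \<exists>s\<in>S. (v, s) \<in> parcs G)"
proof -
  have "independent_set G (insert v S) \<longleftrightarrow> (\<forall>s\<in>S. (v, s) \<notin> parcs G)"
    if "independent_set G S" "v \<in> pverts G" for v
    using that parcs_sym parcs_irrefl unfolding independent_set_def by blast
  moreover have "T = S"
    if "independent_set G T" "S \<subseteq> T" "\<forall>v\<in>pverts G - S. \<exists>s\<in>S. (v, s) \<in> parcs G" for T
    using that unfolding independent_set_def by blast
  ultimately show ?thesis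
    unfolding maximal_independent_set_def by (metis DiffE insertI1 subset_insertI)
qed

text \<open>A witness \<open>T\<close> avoids \<open>near_x\<close> and \<open>near_Y\<close>, as it
  is independent together with \<open>x\<close> and together with \<open>Y\<close>. A vertex of
  \<open>M1\<close> is away from one side of the star, so maximality for that side gives it a
  neighbour in \<open>T\<close>, which then belongs to \<open>M2\<close>. Conversely,
  \<open>S\<close> is enlarged as far as possible outside both closed neighbourhoods.\<close>

lemma generating_iff: "generating G {x} Y \<longleftrightarrow> (\<forall>z\<in>M1s. \<exists>w\<in>M2s. (z, w) \<in> parcs G)" if "chosen_vertices G {x} Y S"
proof
  assume "generating G {x} Y"
  then obtain T where T: "maximal_independent_set G (T \<union> {x})" "maximal_independent_set G (T \<union> Y)"
    unfolding generating_def by blast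
  have TX: "independent_set G (T \<union> {x})" "\<And>v. v \<in> pverts G \<Longrightarrow> v \<notin> T \<union> {x} \<Longrightarrow> \<exists>s\<in>T \<union> {x}. (v, s) \<in> parcs G"
    and TY: "independent_set G (T \<union> Y)" "\<And>v. v \<in> pverts G \<Longrightarrow> v \<notin> T \<union> Y \<Longrightarrow> \<exists>s\<in>T \<union> Y. (v, s) \<in> parcs G"
    using T unfolding maximal_independent_set_iff by blast+
  have T_far: "t \<notin> near_x \<union> near_Y" if "t \<in> T" for t
  proof -
    have "(t, x) \<notin> parcs G" "\<forall>y\<in>Y. (t, y) \<notin> parcs G"
      using TX(1) TY(1) that unfolding independent_set_def by blast+
    then show ?thesis
      using star_verts(3) star_arcs unfolding near_x_def near_Y_def by blast
  qed
  show "\<forall>z\<in>M1s. \<exists>w\<in>M2s. (z, w) \<in> parcs G"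
  proof
    fix z assume z: "z \<in> M1s"
    have "\<exists>w\<in>T. (z, w) \<in> parcs G"
    proof (cases "z \<in> near_x")
      case True
      then have "z \<notin> near_Y" "z \<notin> T" using z T_far unfolding M1_eq by blast+
      then show ?thesis
        using TY(2)[of z] z M1_subset unfolding near_Y_def by blast
    next
      case False
      then have "z \<notin> T" using z T_far unfolding M1_eq by blast
      then show ?thesis
        using TX(2)[of z] z False M1_subset unfolding near_x_def by blast
    qed
    then show "\<exists>w\<in>M2s. (z, w) \<in> parcs G"
      using z T_far parcs_sym unfolding M2_eq by blast
  qed
next
  assume dom: "\<forall>z\<in>M1s. \<exists>w\<in>M2s. (z, w) \<in> parcs G"
  \<comment> \<open>Avoiding both closed neighbourhoods is what keeps a member independent when
    \<open>x\<close> or \<open>Y\<close> is added.\<close>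
  define F where "F = {T. S \<subseteq> T \<and> independent_set G T \<and> T \<inter> (near_x \<union> near_Y) = {}}"
  note chosen = chosen_vertices_complete[OF that]
  have "finite F"
    by (rule finite_subset[of _ "Pow (pverts G)"])
      (auto simp: F_def independent_set_def pair_finite_verts)
  moreover have "S \<in> F"
    using chosen(1,2) unfolding F_def M2_eq by blast
  ultimately obtain T where T: "T \<in> F" and Tmax: "\<And>U. U \<in> F \<Longrightarrow> T \<subseteq> U \<Longrightarrow> U = T"
    using finite_has_maximal2[of F S] by metis
  have indep: "independent_set G T" and far: "T \<inter> (near_x \<union> near_Y) = {}" "S \<subseteq> T"
    using T unfolding F_def independent_set_def by blast+
  have nonadj: "(t, x) \<notin> parcs G \<and> (x, t) \<notin> parcs G" "\<And>y. y \<in> Y \<Longrightarrow> (t, y) \<notin> parcs G \<and> (y, t) \<notin> parcs G"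
    if "t \<in> T" for t
  proof -
    have "t \<notin> near_x" "t \<notin> near_Y"
      using far(1) that by blast+
    then show "(t, x) \<notin> parcs G \<and> (x, t) \<notin> parcs G" "\<And>y. y \<in> Y \<Longrightarrow> (t, y) \<notin> parcs G \<and> (y, t) \<notin> parcs G"
      unfolding near_x_def near_Y_def using parcs_sym by blast+
  qed
  have indepX: "independent_set G (T \<union> {x})"
    using indep nonadj(1) parcs_irrefl star_verts(1) unfolding independent_set_def by auto
  have indepY: "independent_set G (T \<union> Y)"
    using indep nonadj(2) star_arcs(3) star_verts(2) unfolding independent_set_def by auto
  have M1_dom: "\<exists>s\<in>T. (v, s) \<in> parcs G" if "v \<in> M1s" for v
    using dom that chosen(3) far(2) parcs_sym by (meson subsetD)
  \<comment> \<open>An undominated vertex away from both sides could be added to \<open>T\<close>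
    without leaving \<open>F\<close>.\<close>
  have rest: "\<exists>s\<in>T. (v, s) \<in> parcs G" if v: "v \<in> pverts G" "v \<notin> near_x" "v \<notin> near_Y" "v \<notin> T" for v
  proof (rule ccontr)
    assume "\<not> ?thesis"
    then have "independent_set G (insert v T)"
      using indep v(1) parcs_sym parcs_irrefl unfolding independent_set_def by blast
    then have "insert v T \<in> F"
      using T v unfolding F_def by blast
    from Tmax[OF this] v(4) show False by blast
  qed
  have "maximal_independent_set G (T \<union> {x})"
    unfolding maximal_independent_set_iff
  proof (intro conjI ballI indepX)
    fix v assume v: "v \<in> pverts G - (T \<union> {x})"
    show "\<exists>s\<in>T \<union> {x}. (v, s) \<in> parcs G"
    proof (cases "v \<in> near_x")
      case True
      then show ?thesis using v unfolding near_x_def by blast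
    next
      case False
      then show ?thesis using v M1_dom rest unfolding M1_eq by blast
    qed
  qed
  moreover have "maximal_independent_set G (T \<union> Y)"
    unfolding maximal_independent_set_iff
  proof (intro conjI ballI indepY)
    fix v assume v: "v \<in> pverts G - (T \<union> Y)"
    show "\<exists>s\<in>T \<union> Y. (v, s) \<in> parcs G"
    proof (cases "v \<in> near_Y")
      case True
      then show ?thesis using v unfolding near_Y_def by blast
    next
      case False
      then show ?thesis using v M1_dom rest unfolding M1_eq by blast
    qed
  qed
  ultimately show "generating G {x} Y"
    unfolding generating_def using indep by blast
qed

lemma generating_iff_dominates:
  "chosen_vertices G {x} Y S \<Longrightarrow> generating G {x} Y \<longleftrightarrow> dominates_set G S M1s"
  using generating_iff dominates_M1_iff(2) by blast

end

text \<open>An injective key has exactly one maximum in each component, so a choice function can be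
  described by a condition that is testable at each vertex on its own. Monotonicity makes that
  maximum one of \<open>card (f v)\<close> as well.\<close>

lemma (in chordal_star) chosen_vertices_max_key:
  fixes key :: "'a \<Rightarrow> nat"
  assumes inj: "inj_on key M2s"
    and mono: "\<And>u v. u \<in> M2s \<Longrightarrow> v \<in> M2s \<Longrightarrow> key u \<le> key v \<Longrightarrow> card (f u) \<le> card (f v)"
  shows "chosen_vertices G {x} Y {v \<in> M2s. \<forall>u. (v, u) \<in> link\<^sup>* \<longrightarrow> key u \<le> key v}"
proof -
  let ?comps = "M2_components G {x} Y"
  have "\<forall>C\<in>?comps. \<exists>v\<in>C. \<forall>u\<in>C. key u \<le> key v"
  proof
    fix C assume C: "C \<in> ?comps"
    then have "finite (key ` C)" "key ` C \<noteq> {}"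
      using finite_component unfolding M2_components_eq by auto
    then have "Max (key ` C) \<in> key ` C" "\<forall>u\<in>C. key u \<le> Max (key ` C)"
      by auto
    then show "\<exists>v\<in>C. \<forall>u\<in>C. key u \<le> key v"
      by (metis imageE)
  qed
  then obtain g where g: "\<And>C. C \<in> ?comps \<Longrightarrow> g C \<in> C" "\<And>C u. C \<in> ?comps \<Longrightarrow> u \<in> C \<Longrightarrow> key u \<le> key (g C)"
    by metis
  have max: "card (f (g C)) = Max ((\<lambda>v. card (f v)) ` C)" if C: "C \<in> ?comps" for C
  proof (rule Max_eqI[symmetric])
    show "finite ((\<lambda>v. card (f v)) ` C)"
      using finite_component[OF C] by simp
    show "card (f (g C)) \<in> (\<lambda>v. card (f v)) ` C"
      using g(1)[OF C] by simp
    fix m assume "m \<in> (\<lambda>v. card (f v)) ` C"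
    then obtain u where "u \<in> C" "m = card (f u)" by blast
    then show "m \<le> card (f (g C))"
      using mono g C component_subset[OF C] by blast
  qed
  have "{v \<in> M2s. \<forall>u. (v, u) \<in> link\<^sup>* \<longrightarrow> key u \<le> key v} = g ` ?comps"
  proof (intro equalityI subsetI)
    fix v assume v: "v \<in> {v \<in> M2s. \<forall>u. (v, u) \<in> link\<^sup>* \<longrightarrow> key u \<le> key v}"
    then obtain C where C: "C \<in> ?comps" "v \<in> C"
      using component_exists by blast
    have "(v, g C) \<in> link\<^sup>*"
      using component_link[OF C] g(1)[OF C(1)] by blast
    then have "key (g C) = key v"
      using v g(2)[OF C] by (simp add: le_antisym)
    then have "g C = v"
      using inj v g(1)[OF C(1)] component_subset[OF C(1)] by (auto dest: inj_onD)
    then show "v \<in> g ` ?comps"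
      using C(1) by blast
  next
    fix v assume "v \<in> g ` ?comps"
    then obtain C where C: "C \<in> ?comps" "v = g C" by blast
    then have "v \<in> C" using g(1) by blast
    have "key u \<le> key v" if "(v, u) \<in> link\<^sup>*" for u
    proof -
      have "u \<in> C"
        using component_link[OF C(1) \<open>v \<in> C\<close>] that by simp
      then show ?thesis
        using g(2)[OF C(1)] C(2) by simp
    qed
    moreover have "v \<in> M2s"
      using \<open>v \<in> C\<close> component_subset[OF C(1)] by blast
    ultimately show "v \<in> {v \<in> M2s. \<forall>u. (v, u) \<in> link\<^sup>* \<longrightarrow> key u \<le> key v}"
      by simp
  qed
  then show ?thesis
    unfolding chosen_vertices_def using g(1) max by blast
qed

section \<open>Counting loops on the random access machine\<close>

text \<open>Every loop lets its counter run over the vertex numbers. Hence execution is a total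
  function \<open>exec\<close>, the nesting depth bounds the degree of the running time, and
  programs can be verified without the relation \<open>run\<close>.\<close>

datatype prog =
    Pass
  | Upd string expr expr
  | Then prog prog (infixr \<open>;;\<close> 60)
  | If_nz expr prog prog
  | For string prog

abbreviation Var :: "string \<Rightarrow> expr" where "Var a \<equiv> Cell a (Const 0)"

text \<open>
  Assignments store the minimum of the value and \<open>n\<close>. So all cells stay at most \<open>n\<close>, and the words
  are long enough for every expression of bounded size without any further invariant.
\<close>

definition capped :: "expr \<Rightarrow> expr" where "capped e = Sub e (Sub e (Var ''n''))"

primrec compile :: "prog \<Rightarrow> com" where
  "compile Pass = Skip"
| "compile (Upd a i e) = Assign a i (capped e)"
| "compile (c ;; d) = Seq (compile c) (compile d)"
| "compile (If_nz e c d) = Cond e (compile c) (compile d)"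
| "compile (For i c) = Seq (Assign i (Const 0) (Const 0))
     (While (Sub (Var ''n'') (Var i))
       (Seq (compile c) (Assign i (Const 0) (Add (Var i) (Const 1)))))"

primrec exec :: "prog \<Rightarrow> store \<Rightarrow> store" where
  "exec Pass s = s"
| "exec (Upd a i e) s = s(a := (s a)(val s i := min (val s e) (s ''n'' 0)))"
| "exec (c ;; d) s = exec d (exec c s)"
| "exec (If_nz e c d) s = (if val s e \<noteq> 0 then exec c s else exec d s)"
| "exec (For i c) s =
     ((\<lambda>r. (exec c r)(i := (exec c r i)(0 := exec c r i 0 + 1))) ^^ s ''n'' 0) (s(i := (s i)(0 := 0)))"

primrec writes :: "prog \<Rightarrow> string set" where
  "writes Pass = {}"
| "writes (Upd a i e) = {a}"
| "writes (c ;; d) = writes c \<union> writes d"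
| "writes (If_nz e c d) = writes c \<union> writes d"
| "writes (For i c) = insert i (writes c)"

text \<open>In a loop each round pays 6 for the test and 6 for the increment, which makes 12. The 9
  consists of 3 for initialising the counter and 6 for the final failing test.\<close>

primrec steps :: "nat \<Rightarrow> prog \<Rightarrow> nat" where
  "steps n Pass = 1"
| "steps n (Upd a i e) = cost i + cost (capped e) + 1"
| "steps n (c ;; d) = steps n c + steps n d"
| "steps n (If_nz e c d) = cost e + 1 + steps n c + steps n d"
| "steps n (For i c) = n * (steps n c + 12) + 9"

primrec nesting :: "prog \<Rightarrow> nat" where
  "nesting Pass = 0"
| "nesting (Upd a i e) = 0"
| "nesting (c ;; d) = max (nesting c) (nesting d)"
| "nesting (If_nz e c d) = max (nesting c) (nesting d)"
| "nesting (For i c) = Suc (nesting c)"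

primrec bits_consts :: "expr \<Rightarrow> bool" where
  "bits_consts (Const k) \<longleftrightarrow> k \<le> 1"
| "bits_consts (Cell a e) \<longleftrightarrow> bits_consts e"
| "bits_consts (Add d e) \<longleftrightarrow> bits_consts d \<and> bits_consts e"
| "bits_consts (Sub d e) \<longleftrightarrow> bits_consts d \<and> bits_consts e"
| "bits_consts (Mul d e) \<longleftrightarrow> bits_consts d \<and> bits_consts e"

text \<open>\<open>K\<close> bounds the cost of all expressions; 5 is the cost of a loop test.
  Protecting \<open>n\<close> and the counter from assignments in the body guarantees exactly
  \<open>n\<close> rounds.\<close>

primrec admissible :: "nat \<Rightarrow> prog \<Rightarrow> bool" where
  "admissible K Pass \<longleftrightarrow> True"
| "admissible K (Upd a i e) \<longleftrightarrow> a \<noteq> ''n'' \<and> bits_consts i \<and> cost i \<le> K \<and>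
     bits_consts e \<and> cost (capped e) \<le> K"
| "admissible K (c ;; d) \<longleftrightarrow> admissible K c \<and> admissible K d"
| "admissible K (If_nz e c d) \<longleftrightarrow> bits_consts e \<and> cost e \<le> K \<and> admissible K c \<and> admissible K d"
| "admissible K (For i c) \<longleftrightarrow> i \<noteq> ''n'' \<and> i \<notin> writes c \<and> 5 \<le> K \<and> admissible K c"

section \<open>Word sizes and correctness of the compilation\<close>

text \<open>The base is at least 2, so the step that an addition costs supplies the factor by which
  it can at most double a power.\<close>

lemma val_le_power:
  assumes "\<And>a j. s a j \<le> n" "bits_consts e"
  shows "val s e \<le> (n + 2) ^ cost e"
  using assms(2)
proof (induction e)
  case (Const k)
  then show ?case by simp
next
  case (Cell a e)
  have "s a (val s e) \<le> n + 2"
    using assms(1) by (simp add: le_SucI)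
  also have "\<dots> \<le> (n + 2) ^ cost (Cell a e)"
    by (rule self_le_power) auto
  finally show ?case by simp
next
  case (Add d e)
  let ?A = "n + 2"
  have "val s d + val s e \<le> ?A ^ cost d + ?A ^ cost e"
    using Add by auto
  also have "\<dots> \<le> ?A ^ (cost d + cost e) + ?A ^ (cost d + cost e)"
    by (intro add_mono power_increasing) auto
  also have "\<dots> \<le> ?A * ?A ^ (cost d + cost e)"
    by simp
  finally show ?case by simp
next
  case (Sub d e)
  have "val s d \<le> (n + 2) ^ cost d"
    using Sub by simp
  also have "\<dots> \<le> (n + 2) ^ (cost d + cost e + 1)"
    by (intro power_increasing) auto
  finally show ?case by simp
next
  case (Mul d e)
  have "val s d * val s e \<le> (n + 2) ^ cost d * (n + 2) ^ cost e"
    using Mul by (intro mult_mono) auto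
  also have "\<dots> = (n + 2) ^ (cost d + cost e)"
    by (simp add: power_add)
  also have "\<dots> \<le> (n + 2) ^ (cost d + cost e + 1)"
    by (intro power_increasing) auto
  finally show ?case by simp
qed

lemma fits_of_power:
  assumes "\<And>a j. s a j \<le> n" "bits_consts e" "(n + 2) ^ cost e < 2 ^ b"
  shows "fits b s e"
proof -
  have small: "val s e < 2 ^ b" if "bits_consts e" "(n + 2) ^ cost e < 2 ^ b" for e
    using val_le_power[OF assms(1) that(1)] that(2) by (rule le_less_trans)
  have part: "(n + 2) ^ k < 2 ^ b" if "(n + 2) ^ l < 2 ^ b" "k \<le> l" for k l
    using power_increasing[OF that(2), of "n + 2"] that(1) by (meson le_add2 le_less_trans one_le_numeral order_trans)
  show ?thesis
    using assms(2,3)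
  proof (induction e)
    case (Const k)
    then show ?case using small[of "Const k"] by simp
  next
    case (Cell a e)
    then show ?case using small[of "Cell a e"] part[OF Cell.prems(2), of "cost e"] by simp
  next
    case (Add d e)
    then show ?case using small[of "Add d e"] part[OF Add.prems(2), of "cost d"]
      part[OF Add.prems(2), of "cost e"] by simp
  next
    case (Sub d e)
    then show ?case using part[OF Sub.prems(2), of "cost d"]
      part[OF Sub.prems(2), of "cost e"] by simp
  next
    case (Mul d e)
    then show ?case using small[of "Mul d e"] part[OF Mul.prems(2), of "cost d"]
      part[OF Mul.prems(2), of "cost e"] by simp
  qed
qed

text \<open>One inequality between \<open>n\<close>, \<open>K\<close> and \<open>b\<close> thus
  serves all expressions of a program in all its states.\<close>

lemma fits_small:
  assumes "\<And>a j. s a j \<le> n" "(n + 2) ^ K < 2 ^ b" "bits_consts e" "cost e \<le> K"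
  shows "fits b s e"
proof (rule fits_of_power[OF assms(1,3)])
  have "(n + 2) ^ cost e \<le> (n + 2) ^ K"
    using assms(4) by (intro power_increasing) auto
  then show "(n + 2) ^ cost e < 2 ^ b"
    using assms(2) by (rule le_less_trans)
qed

lemma exec_frame: "a \<notin> writes p \<Longrightarrow> exec p s a = s a"
proof (induction p arbitrary: s)
  case (For i c)
  have "((\<lambda>r. (exec c r)(i := (exec c r i)(0 := exec c r i 0 + 1))) ^^ m) r a = r a" for m r
    using For by (induction m) auto
  then show ?case
    using For by simp
qed auto

lemma n_notin_writes: "admissible K p \<Longrightarrow> ''n'' \<notin> writes p"
  by (induction p) auto

text \<open>The bound on the cells is carried through the induction because it alone makes the
  expressions of the next statement fit; the cap restores it after each assignment.\<close>

lemma run_exec: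
  assumes "admissible K p" "\<And>a j. s a j \<le> n" "s ''n'' 0 = n" "1 \<le> n" "(n + 2) ^ K < 2 ^ b"
  shows "(\<exists>t\<le>steps n p. run b (compile p) s t (exec p s)) \<and> (\<forall>a j. exec p s a j \<le> n)"
  using assms(1-3)
proof (induction p arbitrary: s)
  case Pass
  then show ?case using run_Skip[of b s] by auto
next
  case (Upd a i e)
  have "val s (capped e) = min (val s e) (s ''n'' 0)"
    by (simp add: capped_def)
  moreover have "fits b s i" "fits b s (capped e)"
    by (rule fits_small[OF Upd.prems(2) assms(5)]; use Upd.prems in \<open>simp add: capped_def\<close>)+
  ultimately show ?case
    using run_Assign[of b s i "capped e" a] Upd.prems(2,3) by (auto simp: fun_upd_def)
next
  case (Then c d)
  obtain t where t: "t \<le> steps n c" "run b (compile c) s t (exec c s)"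
    and le: "\<And>a j. exec c s a j \<le> n"
    using Then.IH(1)[of s] Then.prems by auto
  have "exec c s ''n'' 0 = n"
    using Then.prems exec_frame[OF n_notin_writes[of K c]] by simp
  then obtain t' where t': "t' \<le> steps n d" "run b (compile d) (exec c s) t' (exec d (exec c s))"
    and le': "\<And>a j. exec d (exec c s) a j \<le> n"
    using Then.IH(2)[of "exec c s"] Then.prems le by auto
  have "run b (compile (c ;; d)) s (t + t') (exec (c ;; d) s)"
    using run_Seq[OF t(2) t'(2)] by simp
  moreover have "t + t' \<le> steps n (c ;; d)"
    using t t' by simp
  moreover have "\<forall>a j. exec (c ;; d) s a j \<le> n"
    using le' by simp
  ultimately show ?case by blast
next
  case (If_nz e c d)
  have fits: "fits b s e"
    by (rule fits_small[OF If_nz.prems(2) assms(5)]) (use If_nz.prems in auto)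
  show ?case
  proof (cases "val s e = 0")
    case True
    then obtain t where t: "t \<le> steps n d" "run b (compile d) s t (exec d s)"
      and le: "\<And>a j. exec d s a j \<le> n"
      using If_nz.IH(2)[of s] If_nz.prems by auto
    have "run b (compile (If_nz e c d)) s (cost e + 1 + t) (exec (If_nz e c d) s)"
      using run_Cond_false[OF fits True t(2)] True by simp
    moreover have "cost e + 1 + t \<le> steps n (If_nz e c d)"
      using t by simp
    moreover have "\<forall>a j. exec (If_nz e c d) s a j \<le> n"
      using le True by simp
    ultimately show ?thesis by blast
  next
    case False
    then obtain t where t: "t \<le> steps n c" "run b (compile c) s t (exec c s)"
      and le: "\<And>a j. exec c s a j \<le> n"
      using If_nz.IH(1)[of s] If_nz.prems by auto
    have "run b (compile (If_nz e c d)) s (cost e + 1 + t) (exec (If_nz e c d) s)"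
      using run_Cond_true[OF fits False t(2)] False by simp
    moreover have "cost e + 1 + t \<le> steps n (If_nz e c d)"
      using t by simp
    moreover have "\<forall>a j. exec (If_nz e c d) s a j \<le> n"
      using le False by simp
    ultimately show ?thesis by blast
  qed
next
  case (For i c)
  define step where "step = (\<lambda>r. (exec c r)(i := (exec c r i)(0 := exec c r i 0 + 1)))"
  define test where "test = Sub (Var ''n'') (Var i)"
  define incr where "incr = Assign i (Const 0) (Add (Var i) (Const 1))"
  have adm: "admissible K c" "i \<noteq> ''n''" "i \<notin> writes c" "5 \<le> K" "''n'' \<notin> writes c"
    using For.prems n_notin_writes by auto
  have fits_test: "fits b r test" if "\<And>a j. r a j \<le> n" for r
    unfolding test_def by (rule fits_small[OF that assms(5)]) (use adm in auto)
  \<comment> \<open>\<open>m\<close> counts the rounds still to come, so the counter never exceeds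
    \<open>n\<close>; the 6 pays for the last test.\<close>
  have loop: "(\<exists>t\<le>m * (steps n c + 12) + 6. run b (While test (Seq (compile c) incr)) r t ((step ^^ m) r)) \<and>
      (\<forall>a j. (step ^^ m) r a j \<le> n)"
    if "\<And>a j. r a j \<le> n" "r ''n'' 0 = n" "r i 0 + m = n" for m r
    using that
  proof (induction m arbitrary: r)
    case 0
    have "run b (While test (Seq (compile c) incr)) r (cost test + 1) r"
      by (rule run_While_false[OF fits_test]) (use 0 in \<open>auto simp: test_def\<close>)
    moreover have "cost test + 1 \<le> 0 * (steps n c + 12) + 6"
      by (simp add: test_def)
    moreover have "\<forall>a j. (step ^^ 0) r a j \<le> n"
      using 0 by simp
    ultimately show ?case
      unfolding funpow_0 by blast
  next
    case (Suc m)
    obtain t where t: "t \<le> steps n c" "run b (compile c) r t (exec c r)"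
      and le: "\<And>a j. exec c r a j \<le> n"
      using For.IH[of r] adm Suc.prems by auto
    have frame: "exec c r i = r i" "exec c r ''n'' = r ''n''"
      using adm exec_frame by auto
    have "run b incr (exec c r) 6 (step r)"
    proof -
      have "fits b (exec c r) (Const 0)" "fits b (exec c r) (Add (Var i) (Const 1))"
        by (rule fits_small[OF le assms(5)]; use adm in simp)+
      from run_Assign[OF this, of i] show ?thesis
        by (simp add: incr_def step_def numeral_eq_Suc)
    qed
    from run_Seq[OF t(2) this]
    have body: "run b (Seq (compile c) incr) r (t + 6) (step r)" .
    have le': "step r a j \<le> n" for a j
      using le Suc.prems frame by (auto simp: step_def)
    moreover have "step r ''n'' 0 = n" "step r i 0 + m = n"
      using adm Suc.prems frame by (auto simp: step_def)
    ultimately obtain t' where t': "t' \<le> m * (steps n c + 12) + 6"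
        "run b (While test (Seq (compile c) incr)) (step r) t' ((step ^^ m) (step r))"
      and le'': "\<And>a j. (step ^^ m) (step r) a j \<le> n"
      using Suc.IH[of "step r"] by blast
    have "val r test \<noteq> 0"
      using Suc.prems by (simp add: test_def)
    from run_While_true[OF fits_test this body t'(2)] Suc.prems(1)
    have "run b (While test (Seq (compile c) incr)) r (cost test + 1 + (t + 6) + t') ((step ^^ Suc m) r)"
      by (simp add: funpow_swap1)
    moreover have "cost test + 1 + (t + 6) + t' \<le> Suc m * (steps n c + 12) + 6"
      using t t' by (simp add: test_def)
    moreover have "\<forall>a j. (step ^^ Suc m) r a j \<le> n"
      using le'' by (simp add: funpow_swap1)
    ultimately show ?case by blast
  qed
  define s0 where "s0 = s(i := (s i)(0 := 0))"
  have "s0 a j \<le> n" "s0 ''n'' 0 = n" "s0 i 0 + n = n" for a j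
    using For.prems adm by (simp_all add: s0_def)
  from loop[of s0 n, OF this] obtain t where t: "t \<le> n * (steps n c + 12) + 6"
      "run b (While test (Seq (compile c) incr)) s0 t ((step ^^ n) s0)"
    and le: "\<And>a j. (step ^^ n) s0 a j \<le> n"
    by blast
  have "run b (Assign i (Const 0) (Const 0)) s 3 s0"
    using run_Assign[of b s "Const 0" "Const 0" i] by (simp add: numeral_eq_Suc s0_def)
  from run_Seq[OF this t(2)]
  have "run b (compile (For i c)) s (3 + t) ((step ^^ n) s0)"
    by (simp add: test_def incr_def)
  moreover have "(step ^^ n) s0 = exec (For i c) s"
    using For.prems(3) by (simp add: step_def s0_def)
  moreover have "3 + t \<le> steps n (For i c)"
    using t by simp
  ultimately show ?case
    using le by metis
qed

text \<open>
  \<open>indep\<close> makes the invariant insensitive to the loop counter, which the loop itself changes.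
\<close>

lemma exec_For:
  assumes "i \<notin> writes c" "''n'' \<notin> writes c" "i \<noteq> ''n''" "s ''n'' 0 = n"
    and indep: "\<And>k r v. P k r \<Longrightarrow> P k (r(i := v))"
    and base: "P 0 s"
    and step: "\<And>k r. k < n \<Longrightarrow> r i 0 = k \<Longrightarrow> (\<And>a. a \<noteq> i \<Longrightarrow> a \<notin> writes c \<Longrightarrow> r a = s a) \<Longrightarrow>
      P k r \<Longrightarrow> P (Suc k) (exec c r)"
  shows "P n (exec (For i c) s)"
proof -
  define advance where "advance = (\<lambda>r. (exec c r)(i := (exec c r i)(0 := exec c r i 0 + 1)))"
  define s0 where "s0 = s(i := (s i)(0 := 0))"
  have "P k ((advance ^^ k) s0) \<and> (advance ^^ k) s0 i 0 = k \<and>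
    (\<forall>a. a \<noteq> i \<longrightarrow> a \<notin> writes c \<longrightarrow> (advance ^^ k) s0 a = s a)" if "k \<le> n" for k
    using that
  proof (induction k)
    case 0
    have "P 0 s0"
      unfolding s0_def by (rule indep[OF base])
    moreover have "s0 i 0 = 0" "a \<noteq> i \<Longrightarrow> s0 a = s a" for a
      by (simp_all add: s0_def)
    ultimately show ?case by simp
  next
    case (Suc k)
    define r where "r = (advance ^^ k) s0"
    have r: "P k r" "r i 0 = k" "\<And>a. a \<noteq> i \<Longrightarrow> a \<notin> writes c \<Longrightarrow> r a = s a"
      using Suc by (simp_all add: r_def)
    have "P (Suc k) (exec c r)"
      using Suc.prems r by (intro step) auto
    then have "P (Suc k) (advance r)"
      unfolding advance_def by (rule indep)
    moreover have "advance r i 0 = Suc k"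
      using r assms(1) exec_frame by (simp add: advance_def)
    moreover have "advance r a = s a" if "a \<noteq> i" "a \<notin> writes c" for a
      using r that exec_frame by (simp add: advance_def)
    ultimately show ?case by (simp add: r_def)
  qed
  then show ?thesis
    using assms(4) by (simp add: advance_def s0_def)
qed

declare exec.simps(5) [simp del]

section \<open>Asymptotic bounds on steps and word length\<close>

text \<open>Only a loop raises the degree. With base \<open>n + 1\<close> all powers are at least 1,
  also for \<open>n = 0\<close>, and absorb additive constants.\<close>

lemma steps_le_power: "\<exists>C. \<forall>n. steps n p \<le> C * (n + 1) ^ nesting p"
proof (induction p)
  case (Then c d)
  then obtain C D where "\<forall>n. steps n c \<le> C * (n + 1) ^ nesting c" "\<forall>n. steps n d \<le> D * (n + 1) ^ nesting d"
    by blast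
  moreover have "(n + 1) ^ nesting c \<le> (n + 1) ^ nesting (c ;; d)"
    "(n + 1) ^ nesting d \<le> (n + 1) ^ nesting (c ;; d)" for n :: nat
    by (intro power_increasing; simp)+
  ultimately have "steps n (c ;; d) \<le> (C + D) * (n + 1) ^ nesting (c ;; d)" for n
    unfolding steps.simps distrib_right by (meson add_mono mult_le_mono2 order_trans)
  then show ?case by blast
next
  case (If_nz e c d)
  then obtain C D where "\<forall>n. steps n c \<le> C * (n + 1) ^ nesting c" "\<forall>n. steps n d \<le> D * (n + 1) ^ nesting d"
    by blast
  moreover have "(n + 1) ^ nesting c \<le> (n + 1) ^ nesting (If_nz e c d)"
    "(n + 1) ^ nesting d \<le> (n + 1) ^ nesting (If_nz e c d)"
    for n :: nat
    by (intro power_increasing; simp)+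
  moreover have "cost e + 1 \<le> (cost e + 1) * (n + 1) ^ nesting (If_nz e c d)" for n :: nat
    by (subst (1) mult_1_right[symmetric]) (intro mult_le_mono2 one_le_power; simp)
  ultimately have "steps n (If_nz e c d) \<le> (cost e + 1 + C + D) * (n + 1) ^ nesting (If_nz e c d)" for n
    unfolding steps.simps distrib_right[of _ D] distrib_right[of _ C]
    by (meson add_mono mult_le_mono2 order_trans)
  then show ?case by blast
next
  case (For i c)
  then obtain C where C: "\<And>n. steps n c \<le> C * (n + 1) ^ nesting c" by blast
  \<comment> \<open>21 collects the 12 per round and the 9 per loop.\<close>
  have "steps n (For i c) \<le> (C + 21) * (n + 1) ^ nesting (For i c)" for n
  proof -
    let ?p = "(n + 1) ^ nesting c"
    have "1 \<le> ?p" by simp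
    then have "steps n c + 12 \<le> (C + 12) * ?p"
      using C[of n] unfolding distrib_right by linarith
    then have "n * (steps n c + 12) \<le> (n + 1) * ((C + 12) * ?p)"
      by (intro mult_mono) auto
    moreover have "9 \<le> 9 * ((n + 1) * ?p)"
      using mult_le_mono[of 1 "n + 1" 1 ?p] by simp
    ultimately show ?thesis
      by (simp add: algebra_simps)
  qed
  then show ?case by blast
qed auto

lemma steps_bigo: "(\<lambda>n. real (steps n p)) \<in> O(\<lambda>n. real n ^ nesting p)"
proof -
  obtain C where C: "\<And>n. steps n p \<le> C * (n + 1) ^ nesting p"
    using steps_le_power by blast
  have "real (steps n p) \<le> (real C * 2 ^ nesting p) * real n ^ nesting p" if "1 \<le> n" for n
  proof -
    have "(n + 1) ^ nesting p \<le> (2 * n) ^ nesting p"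
      using that by (intro power_mono) auto
    then have "steps n p \<le> C * (2 * n) ^ nesting p"
      using C[of n] by (meson mult_le_mono2 order_trans)
    then have "real (steps n p) \<le> real (C * (2 * n) ^ nesting p)"
      by (simp only: of_nat_le_iff)
    then show ?thesis
      by (simp add: power_mult_distrib)
  qed
  then show ?thesis
    by (intro bigoI[of _ "real C * 2 ^ nesting p"] eventually_sequentiallyI[of 1]) simp
qed

text \<open>The base \<open>n + 2\<close> is that of the bound on values; the final 1 makes the
  comparison with the power of two strict.\<close>

definition word_length :: "nat \<Rightarrow> nat \<Rightarrow> nat" where
  "word_length K n = K * nat \<lceil>log 2 (real (n + 2))\<rceil> + 1"

lemma word_length_sufficient: "(n + 2) ^ K < 2 ^ word_length K n"
proof -
  define m where "m = nat \<lceil>log 2 (real (n + 2))\<rceil>"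
  have "0 \<le> log 2 (real (n + 2))"
    by simp
  then have "log 2 (real (n + 2)) \<le> real m"
    unfolding m_def by linarith
  then have "real (n + 2) \<le> 2 ^ m"
    by (simp add: log_le_iff powr_realpow)
  then have "n + 2 \<le> 2 ^ m"
    by (metis of_nat_le_iff of_nat_numeral of_nat_power)
  then have "(n + 2) ^ K \<le> (2 ^ m) ^ K"
    by (rule power_mono) simp
  also have "\<dots> < 2 ^ (K * m + 1)"
    by (simp add: power_mult[symmetric] mult.commute)
  finally show ?thesis
    by (simp add: word_length_def m_def)
qed

lemma word_length_bigo: "(\<lambda>n. real (word_length K n)) \<in> O(\<lambda>n. ln (real n))"
proof -
  \<comment> \<open>For \<open>n\<close> at least 2, \<open>n + 2\<close> is at most the square of
    \<open>n\<close>. This gives two of the three units in \<open>3 * real K\<close>; rounding up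
    gives the third, and the summand 1 of \<open>word_length\<close> gives
    \<open>1 / ln 2\<close>.\<close>
  have "real (word_length K n) \<le> (3 * real K / ln 2 + 1 / ln 2) * ln (real n)" if n: "2 \<le> n" for n
  proof -
    have "2 * n \<le> n * n"
      using n by (intro mult_le_mono1)
    then have "n + 2 \<le> n * n"
      using n by linarith
    then have "real (n + 2) \<le> real n * real n"
      by (metis of_nat_le_iff of_nat_mult)
    then have "ln (real (n + 2)) \<le> ln (real n * real n)"
      using n by (subst ln_le_cancel_iff) auto
    then have "ln (real (n + 2)) \<le> 2 * ln (real n)"
      using n by (simp add: ln_mult)
    then have log: "log 2 (real (n + 2)) \<le> 2 * ln (real n) / ln 2"
      by (simp add: log_def divide_right_mono)
    have one: "1 \<le> ln (real n) / ln 2"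
      using n by simp
    have "0 \<le> log 2 (real (n + 2))"
      by simp
    then have "real (nat \<lceil>log 2 (real (n + 2))\<rceil>) \<le> log 2 (real (n + 2)) + 1"
      by linarith
    also have "\<dots> \<le> 3 * ln (real n) / ln 2"
      using log one by (simp add: add_divide_distrib[symmetric] field_simps)
    finally have "real K * real (nat \<lceil>log 2 (real (n + 2))\<rceil>) \<le> real K * (3 * ln (real n) / ln 2)"
      by (rule mult_left_mono) simp
    then have "real (word_length K n) \<le> real K * (3 * ln (real n) / ln 2) + ln (real n) / ln 2"
      unfolding word_length_def of_nat_add of_nat_mult using one by linarith
    then show ?thesis
      by (simp add: algebra_simps add_divide_distrib)
  qed
  then show ?thesis
    by (intro bigoI[of _ "3 * real K / ln 2 + 1 / ln 2"] eventually_sequentiallyI[of 2]) simp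
qed

section \<open>The algorithm\<close>

text \<open>For loops that fill an array cell by cell. The body may also read \<open>A\<close>,
  whose entries from \<open>k\<close> on still have their initial values.\<close>

lemma exec_For_pointwise:
  assumes "A \<noteq> i" "i \<notin> writes c" "''n'' \<notin> writes c" "i \<noteq> ''n''" "s ''n'' 0 = n"
    and body: "\<And>k r. k < n \<Longrightarrow> r i 0 = k \<Longrightarrow> (\<And>a. a \<noteq> i \<Longrightarrow> a \<notin> writes c \<Longrightarrow> r a = s a) \<Longrightarrow>
      r A = (\<lambda>j. if j < k then h j else s A j) \<Longrightarrow> exec c r A = (r A)(k := h k)"
  shows "exec (For i c) s A = (\<lambda>j. if j < n then h j else s A j)"
proof (rule exec_For[where P = "\<lambda>k r. r A = (\<lambda>j. if j < k then h j else s A j)"])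
  fix k r
  assume "k < n" "r i 0 = k" "\<And>a. a \<noteq> i \<Longrightarrow> a \<notin> writes c \<Longrightarrow> r a = s a"
    and r: "r A = (\<lambda>j. if j < k then h j else s A j)"
  then have "exec c r A = (r A)(k := h k)"
    by (rule body)
  then show "exec c r A = (\<lambda>j. if j < Suc k then h j else s A j)"
    unfolding r by auto
qed (use assms in auto)

text \<open>A search loop evaluates an existential quantifier: the first hit sets the cell to
  \<open>b\<close> and later rounds can only write \<open>b\<close> again.\<close>

lemma exec_For_search:
  assumes "A \<noteq> u" "u \<noteq> ''n''" "A \<noteq> ''n''" "s ''n'' 0 = n" "b \<le> n"
    and idx: "\<And>r. (\<And>a. a \<noteq> u \<Longrightarrow> a \<noteq> A \<Longrightarrow> r a = s a) \<Longrightarrow> val r idx = j"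
    and test: "\<And>k r. k < n \<Longrightarrow> r u 0 = k \<Longrightarrow> (\<And>a. a \<noteq> u \<Longrightarrow> a \<noteq> A \<Longrightarrow> r a = s a) \<Longrightarrow>
      val r e \<noteq> 0 \<longleftrightarrow> Q k"
  shows "exec (For u (If_nz e (Upd A idx (Const b)) Pass)) s A
    = (s A)(j := if \<exists>k<n. Q k then b else s A j)"
proof (rule exec_For[where P = "\<lambda>m r. r A = (s A)(j := if \<exists>k<m. Q k then b else s A j)"])
  fix k r
  assume k: "k < n" "r u 0 = k" and frame: "\<And>a. a \<noteq> u \<Longrightarrow> a \<notin> writes (If_nz e (Upd A idx (Const b)) Pass) \<Longrightarrow> r a = s a"
    and r: "r A = (s A)(j := if \<exists>m<k. Q m then b else s A j)"
  have frame': "a \<noteq> u \<Longrightarrow> a \<noteq> A \<Longrightarrow> r a = s a" for a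
    using frame by simp
  have "val r idx = j" "val r e \<noteq> 0 \<longleftrightarrow> Q k"
    using idx[OF frame'] test[OF k frame'] by blast+
  moreover have "r ''n'' 0 = n"
    using frame'[of "''n''"] assms by simp
  ultimately show "exec (If_nz e (Upd A idx (Const b)) Pass) r A
      = (s A)(j := if \<exists>m<Suc k. Q m then b else s A j)"
    using r \<open>b \<le> n\<close> by (auto simp: less_Suc_eq fun_upd_def)
qed (use assms in auto)

section \<open>Subprograms for neighbourhoods, \<open>M1\<close>, \<open>f\<close>,
  \<open>M2\<close>, the choice and the answer\<close>

definition entry :: "string \<Rightarrow> string \<Rightarrow> expr" where "entry a i = Cell a (Var i)"

definition edge :: "expr \<Rightarrow> expr \<Rightarrow> expr" where
  "edge d e = Cell ''adj'' (Add (Mul d (Var ''n'')) e)"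

text \<open>Truncated subtraction makes this 1 exactly when \<open>e\<close> is 0; applied twice it
  normalises a number to a truth value.\<close>

definition neg :: "expr \<Rightarrow> expr" where "neg e = Sub (Const 1) e"

definition closed_nbhd_prog :: "string \<Rightarrow> string \<Rightarrow> prog" where
  "closed_nbhd_prog a d = For ''v''
     (Upd d (Var ''v'') (entry a ''v'') ;;
      For ''u'' (If_nz (Mul (entry a ''u'') (edge (Var ''v'') (Var ''u'')))
        (Upd d (Var ''v'') (Const 1)) Pass))"

definition represents :: "nat \<Rightarrow> (nat \<Rightarrow> nat) \<Rightarrow> nat set \<Rightarrow> bool" where
  "represents n a S \<longleftrightarrow> (\<forall>v<n. a v = of_bool (v \<in> S))"

text \<open>\<open>1 \<le> n\<close> ensures that the cap on assignments preserves the truth value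
  1.\<close>

definition graph_store :: "nat \<Rightarrow> nat rel \<Rightarrow> store \<Rightarrow> bool" where
  "graph_store n E s \<longleftrightarrow> 1 \<le> n \<and> s ''n'' 0 = n \<and>
    (\<forall>u<n. \<forall>v<n. s ''adj'' (u * n + v) = of_bool ((u, v) \<in> E))"

lemma graph_store_frame:
  "graph_store n E s \<Longrightarrow> r ''n'' = s ''n'' \<Longrightarrow> r ''adj'' = s ''adj'' \<Longrightarrow> graph_store n E r"
  by (simp add: graph_store_def)

lemma val_edge:
  "graph_store n E s \<Longrightarrow> val s d < n \<Longrightarrow> val s e < n \<Longrightarrow> val s (edge d e) = of_bool ((val s d, val s e) \<in> E)"
  by (simp add: graph_store_def edge_def)

lemma closed_nbhd_prog_correct:
  assumes "graph_store n E s" "represents n (s a) S"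
    and names: "a \<noteq> d" "a \<notin> {''n'', ''adj'', ''u'', ''v''}" "d \<notin> {''n'', ''adj'', ''u'', ''v''}"
  shows "represents n (exec (closed_nbhd_prog a d) s d) {v. v \<in> S \<or> (\<exists>u<n. u \<in> S \<and> (v, u) \<in> E)}"
proof -
  have distinct_names: "a \<noteq> d" "a \<noteq> ''n''" "a \<noteq> ''adj''" "a \<noteq> ''u''" "a \<noteq> ''v''"
    "d \<noteq> ''n''" "d \<noteq> ''adj''" "d \<noteq> ''u''" "d \<noteq> ''v''"
    "''n'' \<noteq> d" "''adj'' \<noteq> d" "''u'' \<noteq> d" "''v'' \<noteq> d"
    using names by auto
  let ?c = "For ''u'' (If_nz (Mul (entry a ''u'') (edge (Var ''v'') (Var ''u''))) (Upd d (Var ''v'') (Const 1)) Pass)"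
  have n: "s ''n'' 0 = n" "1 \<le> n"
    using assms(1) by (auto simp: graph_store_def)
  have "exec (closed_nbhd_prog a d) s d
      = (\<lambda>j. if j < n then of_bool (j \<in> S \<or> (\<exists>u<n. u \<in> S \<and> (j, u) \<in> E)) else s d j)"
    unfolding closed_nbhd_prog_def
  proof (rule exec_For_pointwise)
    fix k r
    assume k: "k < n" "r ''v'' 0 = k"
      and frame: "\<And>b. b \<noteq> ''v'' \<Longrightarrow> b \<notin> writes (Upd d (Var ''v'') (entry a ''v'') ;; ?c) \<Longrightarrow> r b = s b"
    have frame': "b \<notin> {''u'', ''v'', d} \<Longrightarrow> r b = s b" for b
      using frame by simp
    define q where "q = exec (Upd d (Var ''v'') (entry a ''v'')) r"
    have "r ''n'' 0 = n"
      using frame'[of "''n''"] distinct_names n by auto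
    then have qd: "q d = (r d)(k := of_bool (k \<in> S))"
      using k distinct_names frame'[of a] n assms(2)
      by (simp add: q_def entry_def represents_def)
    have q: "b \<notin> {''u'', ''v'', d} \<Longrightarrow> q b = s b" "q ''v'' 0 = k" for b
      using frame' distinct_names k by (simp_all add: q_def)
    have qc: "exec ?c q d = (q d)(k := if \<exists>u<n. u \<in> S \<and> (k, u) \<in> E then 1 else q d k)"
    proof (rule exec_For_search)
      show "val t (Var ''v'') = k" if "\<And>b. b \<noteq> ''u'' \<Longrightarrow> b \<noteq> d \<Longrightarrow> t b = q b" for t
        using that[of "''v''"] distinct_names q by simp
      show "val t (Mul (entry a ''u'') (edge (Var ''v'') (Var ''u''))) \<noteq> 0 \<longleftrightarrow> m \<in> S \<and> (k, m) \<in> E"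
        if m: "m < n" "t ''u'' 0 = m" and t: "\<And>b. b \<noteq> ''u'' \<Longrightarrow> b \<noteq> d \<Longrightarrow> t b = q b" for m t
      proof -
        have "graph_store n E t"
          using assms(1) by (rule graph_store_frame) (use t q distinct_names in auto)
        then have "val t (edge (Var ''v'') (Var ''u'')) = of_bool ((k, m) \<in> E)"
          using t[of "''v''"] q distinct_names m k by (subst val_edge) auto
        moreover have "val t (entry a ''u'') = of_bool (m \<in> S)"
          using t[of a] q(1)[of a] distinct_names m assms(2) by (simp add: entry_def represents_def)
        ultimately show ?thesis by simp
      qed
    qed (use distinct_names q n in auto)
    show "exec (Upd d (Var ''v'') (entry a ''v'') ;; ?c) r d
        = (r d)(k := of_bool (k \<in> S \<or> (\<exists>u<n. u \<in> S \<and> (k, u) \<in> E)))"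
      unfolding exec.simps(3) q_def[symmetric] qc qd by auto
  qed (use distinct_names n in auto)
  then show ?thesis
    by (simp add: represents_def)
qed

definition centre_nbhd_prog :: prog where
  "centre_nbhd_prog = For ''v'' (Upd ''cx'' (Var ''v'') (edge (Var ''v'') (Var ''x''))) ;;
     Upd ''cx'' (Var ''x'') (Const 1)"

lemma centre_nbhd_prog_correct:
  assumes "graph_store n E s" "s ''x'' 0 = x" "x < n"
  shows "represents n (exec centre_nbhd_prog s ''cx'') {v. v = x \<or> (v, x) \<in> E}"
proof -
  let ?c = "Upd ''cx'' (Var ''v'') (edge (Var ''v'') (Var ''x''))"
  have n: "s ''n'' 0 = n" "1 \<le> n"
    using assms(1) by (auto simp: graph_store_def)
  have "exec (For ''v'' ?c) s ''cx'' = (\<lambda>j. if j < n then of_bool ((j, x) \<in> E) else s ''cx'' j)"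
  proof (rule exec_For_pointwise)
    fix k r
    assume k: "k < n" "r ''v'' 0 = k" and frame: "\<And>b. b \<noteq> ''v'' \<Longrightarrow> b \<notin> writes ?c \<Longrightarrow> r b = s b"
    have "graph_store n E r"
      using assms(1) by (rule graph_store_frame) (use frame in auto)
    then have "val r (edge (Var ''v'') (Var ''x'')) = of_bool ((k, x) \<in> E)"
      using frame[of "''x''"] assms k by (subst val_edge) auto
    then show "exec ?c r ''cx'' = (r ''cx'')(k := of_bool ((k, x) \<in> E))"
      using frame[of "''n''"] n k by simp
  qed (use n in auto)
  moreover have "exec (For ''v'' ?c) s ''x'' = s ''x''" "exec (For ''v'' ?c) s ''n'' = s ''n''"
    by (intro exec_frame; simp)+
  ultimately show ?thesis
    using n assms(2,3) unfolding centre_nbhd_prog_def represents_def exec.simps(2,3)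
    by simp
qed

text \<open>On truth values the sum of the two truncated differences is exclusive or, hence the
  symmetric difference of the two closed neighbourhoods.\<close>

definition M1_prog :: prog where
  "M1_prog = For ''v'' (Upd ''M1'' (Var ''v'')
     (Add (Sub (entry ''cx'' ''v'') (entry ''cy'' ''v'')) (Sub (entry ''cy'' ''v'') (entry ''cx'' ''v''))))"

lemma M1_prog_correct:
  assumes "s ''n'' 0 = n" "1 \<le> n" "represents n (s ''cx'') A" "represents n (s ''cy'') B"
  shows "represents n (exec M1_prog s ''M1'') ((A - B) \<union> (B - A))"
proof -
  have "exec M1_prog s ''M1'' = (\<lambda>j. if j < n then of_bool (j \<in> (A - B) \<union> (B - A)) else s ''M1'' j)"
    unfolding M1_prog_def
  proof (rule exec_For_pointwise)
    fix k r
    assume k: "k < n" "r ''v'' 0 = k"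
      and frame: "\<And>b. b \<noteq> ''v'' \<Longrightarrow> b \<notin> writes (Upd ''M1'' (Var ''v'')
     (Add (Sub (entry ''cx'' ''v'') (entry ''cy'' ''v'')) (Sub (entry ''cy'' ''v'') (entry ''cx'' ''v'')))) \<Longrightarrow> r b = s b"
    show "exec (Upd ''M1'' (Var ''v'')
     (Add (Sub (entry ''cx'' ''v'') (entry ''cy'' ''v'')) (Sub (entry ''cy'' ''v'') (entry ''cx'' ''v'')))) r ''M1''
       = (r ''M1'')(k := of_bool (k \<in> (A - B) \<union> (B - A)))"
      using k assms frame[of "''cx''"] frame[of "''cy''"] frame[of "''n''"]
      by (auto simp: entry_def represents_def)
  qed (use assms in auto)
  then show ?thesis by (simp add: represents_def)
qed

definition f_prog :: prog where
  "f_prog = For ''v'' (For ''u'' (If_nz (Mul (entry ''M1'' ''u'') (edge (Var ''v'') (Var ''u'')))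
     (Upd ''f'' (Var ''v'') (Add (entry ''f'' ''v'') (Const 1))) Pass))"

lemma f_prog_correct:
  assumes "graph_store n E s" "represents n (s ''M1'') A" "s ''f'' = (\<lambda>_. 0)" "v < n"
  shows "exec f_prog s ''f'' v = card {u. u < n \<and> u \<in> A \<and> (v, u) \<in> E}"
proof -
  let ?b = "If_nz (Mul (entry ''M1'' ''u'') (edge (Var ''v'') (Var ''u'')))
     (Upd ''f'' (Var ''v'') (Add (entry ''f'' ''v'') (Const 1))) Pass"
  have n: "s ''n'' 0 = n" "1 \<le> n"
    using assms(1) by (auto simp: graph_store_def)
  have "exec f_prog s ''f'' = (\<lambda>j. if j < n then card {u. u < n \<and> u \<in> A \<and> (j, u) \<in> E} else s ''f'' j)"
    unfolding f_prog_def
  proof (rule exec_For_pointwise)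
    fix k r
    assume k: "k < n" "r ''v'' 0 = k"
      and frame: "\<And>b. b \<noteq> ''v'' \<Longrightarrow> b \<notin> writes (For ''u'' ?b) \<Longrightarrow> r b = s b"
      and r: "r ''f'' = (\<lambda>j. if j < k then card {u. u < n \<and> u \<in> A \<and> (j, u) \<in> E} else s ''f'' j)"
    have "exec (For ''u'' ?b) r ''f'' = (r ''f'')(k := card {u. u < n \<and> u \<in> A \<and> (k, u) \<in> E})"
    proof (rule exec_For[where P = "\<lambda>m q. q ''f'' = (r ''f'')(k := card {u. u < m \<and> u \<in> A \<and> (k, u) \<in> E})"])
      fix m q
      assume m: "m < n" "q ''u'' 0 = m"
        and frame': "\<And>b. b \<noteq> ''u'' \<Longrightarrow> b \<notin> writes ?b \<Longrightarrow> q b = r b"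
        and q: "q ''f'' = (r ''f'')(k := card {u. u < m \<and> u \<in> A \<and> (k, u) \<in> E})"
      have fr: "b \<notin> {''u'', ''v'', ''f''} \<Longrightarrow> q b = s b" "q ''v'' 0 = k" for b
        using frame frame' k by auto
      have "graph_store n E q"
        using assms(1) by (rule graph_store_frame) (use fr in auto)
      then have "val q (edge (Var ''v'') (Var ''u'')) = of_bool ((k, m) \<in> E)"
        using fr m k by (subst val_edge) auto
      moreover have "val q (entry ''M1'' ''u'') = of_bool (m \<in> A)"
        using fr(1)[of "''M1''"] m assms(2) by (simp add: entry_def represents_def)
      moreover have "{u. u < Suc m \<and> u \<in> A \<and> (k, u) \<in> E} =
          (if m \<in> A \<and> (k, m) \<in> E then insert m {u. u < m \<and> u \<in> A \<and> (k, u) \<in> E}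
           else {u. u < m \<and> u \<in> A \<and> (k, u) \<in> E})"
        by (auto simp: less_Suc_eq)
      \<comment> \<open>After \<open>m\<close> rounds the counter is at most \<open>m\<close>, so
        incrementing it never meets the cap.\<close>
      moreover have "card {u. u < m \<and> u \<in> A \<and> (k, u) \<in> E} \<le> m"
        using card_mono[of "{..<m}" "{u. u < m \<and> u \<in> A \<and> (k, u) \<in> E}"] by auto
      ultimately show "exec ?b q ''f'' = (r ''f'')(k := card {u. u < Suc m \<and> u \<in> A \<and> (k, u) \<in> E})"
        using fr(1)[of "''n''"] fr(2) q n m by (simp add: entry_def)
    qed (use r k n frame[of "''n''"] assms(3) in \<open>auto simp: fun_eq_iff\<close>)
    then show "exec (For ''u'' ?b) r ''f'' = (r ''f'')(k := card {u. u < n \<and> u \<in> A \<and> (k, u) \<in> E})" .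
  qed (use n in auto)
  then show ?thesis
    using assms(4) by simp
qed

text \<open>By now \<open>f\<close> is known for all vertices, and a non-zero value says that there
  is a neighbour in \<open>M1\<close>.\<close>

definition M2_prog :: prog where
  "M2_prog = For ''v'' (Upd ''M2'' (Var ''v'')
     (Mul (Mul (neg (entry ''cx'' ''v'')) (neg (entry ''cy'' ''v''))) (neg (neg (entry ''f'' ''v'')))))"

lemma M2_prog_correct:
  assumes "s ''n'' 0 = n" "1 \<le> n" "represents n (s ''cx'') A" "represents n (s ''cy'') B"
  shows "represents n (exec M2_prog s ''M2'') {v. v \<notin> A \<union> B \<and> s ''f'' v \<noteq> 0}"
proof -
  let ?c = "Upd ''M2'' (Var ''v'')
     (Mul (Mul (neg (entry ''cx'' ''v'')) (neg (entry ''cy'' ''v''))) (neg (neg (entry ''f'' ''v''))))"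
  have "exec M2_prog s ''M2'' = (\<lambda>j. if j < n then of_bool (j \<notin> A \<union> B \<and> s ''f'' j \<noteq> 0) else s ''M2'' j)"
    unfolding M2_prog_def
  proof (rule exec_For_pointwise)
    fix k r
    assume k: "k < n" "r ''v'' 0 = k"
      and frame: "\<And>b. b \<noteq> ''v'' \<Longrightarrow> b \<notin> writes ?c \<Longrightarrow> r b = s b"
    show "exec ?c r ''M2'' = (r ''M2'')(k := of_bool (k \<notin> A \<union> B \<and> s ''f'' k \<noteq> 0))"
      using k assms frame[of "''cx''"] frame[of "''cy''"] frame[of "''n''"] frame[of "''f''"]
      by (auto simp: entry_def represents_def neg_def)
  qed (use assms in auto)
  then show ?thesis by (simp add: represents_def)
qed

text \<open>Equality as the vanishing of both truncated differences.\<close>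

definition same :: "expr \<Rightarrow> expr \<Rightarrow> expr" where
  "same d e = Mul (neg (Sub d e)) (neg (Sub e d))"

text \<open>The vertex number breaks ties, so that each component has exactly one vertex of maximal key.\<close>

definition key :: "string \<Rightarrow> expr" where
  "key i = Add (Mul (entry ''f'' i) (Var ''n'')) (Var i)"

text \<open>Starts from \<open>M2\<close> and discards a vertex beaten by one with the same label.
  Keys may exceed the cap, so they are recomputed in the test and never stored.\<close>

definition choose_prog :: prog where
  "choose_prog = For ''v'' (Upd ''S'' (Var ''v'') (entry ''M2'' ''v'') ;;
     For ''u'' (If_nz (Mul (same (entry ''component'' ''u'') (entry ''component'' ''v'')) (Sub (key ''u'') (key ''v'')))
       (Upd ''S'' (Var ''v'') (Const 0)) Pass))"

lemma choose_prog_correct: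
  assumes "s ''n'' 0 = n" "1 \<le> n" "represents n (s ''M2'') M"
  shows "represents n (exec choose_prog s ''S'')
    {v \<in> M. \<forall>u<n. s ''component'' u = s ''component'' v \<longrightarrow> s ''f'' u * n + u \<le> s ''f'' v * n + v}"
proof -
  define Q where "Q v u \<longleftrightarrow> s ''component'' u = s ''component'' v \<and> s ''f'' v * n + v < s ''f'' u * n + u" for v u
  let ?e = "Mul (same (entry ''component'' ''u'') (entry ''component'' ''v'')) (Sub (key ''u'') (key ''v''))"
  let ?c = "For ''u'' (If_nz ?e (Upd ''S'' (Var ''v'') (Const 0)) Pass)"
  have "exec choose_prog s ''S'' = (\<lambda>j. if j < n then of_bool (j \<in> M \<and> \<not> (\<exists>u<n. Q j u)) else s ''S'' j)"
    unfolding choose_prog_def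
  proof (rule exec_For_pointwise)
    fix k r
    assume k: "k < n" "r ''v'' 0 = k"
      and frame: "\<And>b. b \<noteq> ''v'' \<Longrightarrow> b \<notin> writes (Upd ''S'' (Var ''v'') (entry ''M2'' ''v'') ;; ?c) \<Longrightarrow> r b = s b"
    have frame': "b \<notin> {''u'', ''v'', ''S''} \<Longrightarrow> r b = s b" for b
      using frame by simp
    define q where "q = exec (Upd ''S'' (Var ''v'') (entry ''M2'' ''v'')) r"
    have qd: "q ''S'' = (r ''S'')(k := of_bool (k \<in> M))"
      using k frame'[of "''M2''"] frame'[of "''n''"] assms
      by (simp add: q_def entry_def represents_def)
    have q: "b \<notin> {''u'', ''v'', ''S''} \<Longrightarrow> q b = s b" "q ''v'' 0 = k" for b
      using frame' k by (simp_all add: q_def)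
    have qc: "exec ?c q ''S'' = (q ''S'')(k := if \<exists>u<n. Q k u then 0 else q ''S'' k)"
    proof (rule exec_For_search)
      show "val t (Var ''v'') = k" if "\<And>b. b \<noteq> ''u'' \<Longrightarrow> b \<noteq> ''S'' \<Longrightarrow> t b = q b" for t
        using that[of "''v''"] q by simp
      show "val t ?e \<noteq> 0 \<longleftrightarrow> Q k m"
        if m: "m < n" "t ''u'' 0 = m" and t: "\<And>b. b \<noteq> ''u'' \<Longrightarrow> b \<noteq> ''S'' \<Longrightarrow> t b = q b" for m t
        using t[of "''v''"] t[of "''component''"] t[of "''f''"] t[of "''n''"] q(2) q(1)[of "''component''"]
          q(1)[of "''f''"] q(1)[of "''n''"] m assms(1)
        by (auto simp: Q_def same_def key_def entry_def neg_def)
    qed (use q assms in auto)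
    show "exec (Upd ''S'' (Var ''v'') (entry ''M2'' ''v'') ;; ?c) r ''S''
        = (r ''S'')(k := of_bool (k \<in> M \<and> \<not> (\<exists>u<n. Q k u)))"
      unfolding exec.simps(3) q_def[symmetric] qc qd by auto
  qed (use assms in auto)
  then show ?thesis
    by (auto simp: represents_def Q_def not_less)
qed

definition answer_prog :: prog where
  "answer_prog = Upd ''answer'' (Const 0) (Const 1) ;;
     For ''v'' (If_nz (Mul (entry ''M1'' ''v'') (neg (entry ''dom'' ''v''))) (Upd ''answer'' (Const 0) (Const 0)) Pass)"

lemma answer_prog_correct:
  assumes "s ''n'' 0 = n" "1 \<le> n" "represents n (s ''M1'') A" "represents n (s ''dom'') D"
  shows "exec answer_prog s ''answer'' 0 = of_bool (\<forall>v<n. v \<in> A \<longrightarrow> v \<in> D)"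
proof -
  let ?c = "For ''v'' (If_nz (Mul (entry ''M1'' ''v'') (neg (entry ''dom'' ''v''))) (Upd ''answer'' (Const 0) (Const 0)) Pass)"
  define q where "q = exec (Upd ''answer'' (Const 0) (Const 1)) s"
  have q: "q ''answer'' 0 = 1" "b \<noteq> ''answer'' \<Longrightarrow> q b = s b" for b
    using assms by (auto simp: q_def)
  have "exec ?c q ''answer'' = (q ''answer'')(0 := if \<exists>v<n. v \<in> A \<and> v \<notin> D then 0 else q ''answer'' 0)"
  proof (rule exec_For_search)
    show "val t (Mul (entry ''M1'' ''v'') (neg (entry ''dom'' ''v''))) \<noteq> 0 \<longleftrightarrow> m \<in> A \<and> m \<notin> D"
      if m: "m < n" "t ''v'' 0 = m" and t: "\<And>b. b \<noteq> ''v'' \<Longrightarrow> b \<noteq> ''answer'' \<Longrightarrow> t b = q b" for m t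
      using t[of "''M1''"] t[of "''dom''"] q(2)[of "''M1''"] q(2)[of "''dom''"] m assms
      by (auto simp: entry_def neg_def represents_def)
  qed (use q assms in auto)
  then show ?thesis
    using q unfolding answer_prog_def exec.simps(3) q_def[symmetric] by (auto simp del: exec.simps)
qed

section \<open>Labelling the components\<close>

text \<open>
  The labelling \<open>c\<close> uses \<open>0\<close> for unlabelled vertices, and \<open>p\<close> marks the vertices whose neighbours have
  been labelled. That labelled unmarked vertices share one label, the fourth condition, is what
  prevents two labels from meeting.
\<close>

definition partial_labelling :: "nat \<Rightarrow> nat set \<Rightarrow> nat rel \<Rightarrow> nat \<Rightarrow> (nat \<Rightarrow> nat) \<Rightarrow> (nat \<Rightarrow> nat) \<Rightarrow> bool" where
  "partial_labelling n M E k c p \<longleftrightarrow>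
     (\<forall>v<n. c v \<noteq> 0 \<longrightarrow> v \<in> M \<and> (\<exists>r\<in>M. c v = Suc r \<and> (r, v) \<in> (E \<inter> M \<times> M)\<^sup>*)) \<and>
     (\<forall>v<n. p v \<noteq> 0 \<longrightarrow> c v \<noteq> 0) \<and>
     (\<forall>u<n. \<forall>v\<in>M. p u \<noteq> 0 \<longrightarrow> (u, v) \<in> E \<longrightarrow> c v = c u) \<and>
     (\<forall>u<n. \<forall>v<n. c u \<noteq> 0 \<longrightarrow> p u = 0 \<longrightarrow> c v \<noteq> 0 \<longrightarrow> p v = 0 \<longrightarrow> c u = c v) \<and>
     (k \<le> card {v. v < n \<and> p v \<noteq> 0} \<or> (\<forall>v\<in>M. p v \<noteq> 0))"

text \<open>The label \<open>l\<close> spreads to the unlabelled neighbours of \<open>u\<close> in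
  \<open>M\<close>. A neighbour labelled before already carries \<open>l\<close>: if unmarked, by
  the fourth condition, and if marked, by the third condition for the reverse arc. In particular a
  new root, labelled \<open>Suc u\<close> because 0 means unlabelled, has no labelled
  neighbour.\<close>

lemma partial_labelling_step:
  assumes inv: "partial_labelling n M E k c p" and M: "M \<subseteq> {..<n}" and E: "sym E" "irrefl E"
    and u: "u < n" "c u \<noteq> 0 \<and> p u = 0 \<or> u \<in> M \<and> c u = 0 \<and> (\<forall>v<n. c v \<noteq> 0 \<longrightarrow> p v \<noteq> 0)"
    and l: "l = (if c u \<noteq> 0 then c u else Suc u)"
  shows "partial_labelling n M E (Suc k)
    (\<lambda>v. if v = u \<or> v < n \<and> v \<in> M \<and> (u, v) \<in> E \<and> c v = 0 then l else c v) (p(u := 1))"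
proof -
  let ?c = "\<lambda>v. if v = u \<or> v < n \<and> v \<in> M \<and> (u, v) \<in> E \<and> c v = 0 then l else c v"
  let ?p = "p(u := 1)"
  let ?R = "(E \<inter> M \<times> M)\<^sup>*"
  from inv have i1: "\<And>v. v < n \<Longrightarrow> c v \<noteq> 0 \<Longrightarrow> v \<in> M \<and> (\<exists>r\<in>M. c v = Suc r \<and> (r, v) \<in> ?R)"
    and i2: "\<And>v. v < n \<Longrightarrow> p v \<noteq> 0 \<Longrightarrow> c v \<noteq> 0"
    and i3: "\<And>u v. u < n \<Longrightarrow> v \<in> M \<Longrightarrow> p u \<noteq> 0 \<Longrightarrow> (u, v) \<in> E \<Longrightarrow> c v = c u"
    and i4: "\<And>u v. u < n \<Longrightarrow> v < n \<Longrightarrow> c u \<noteq> 0 \<Longrightarrow> p u = 0 \<Longrightarrow> c v \<noteq> 0 \<Longrightarrow> p v = 0 \<Longrightarrow> c u = c v"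
    and i5: "k \<le> card {v. v < n \<and> p v \<noteq> 0} \<or> (\<forall>v\<in>M. p v \<noteq> 0)"
    unfolding partial_labelling_def by blast+
  have uM: "u \<in> M"
    using u i1 by blast
  have pu: "p u = 0"
    using u i2 by blast
  have cu: "?c u = l" "l \<noteq> 0"
    using l by auto
  obtain r where r: "r \<in> M" "l = Suc r" "(r, u) \<in> ?R"
  proof (cases "c u = 0")
    case True
    then show ?thesis using that[of u] uM l by simp
  next
    case False
    then show ?thesis using that i1[OF u(1)] l by auto
  qed
  have nbr: "c v = l" if "v \<in> M" "(u, v) \<in> E" "c v \<noteq> 0" for v
  proof (cases "p v = 0")
    case True
    have "v < n" using that M by blast
    then have "c u \<noteq> 0" using u(2) that(3) True by blast
    then show ?thesis using i4[OF u(1) \<open>v < n\<close>] pu that(3) True l by simp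
  next
    case False
    have "v < n" using that M by blast
    moreover have "(v, u) \<in> E" using that(2) E(1) by (rule symD[rotated])
    ultimately have "c u = c v" using i3 uM False by blast
    then show ?thesis using that(3) l by simp
  qed
  have 1: "v \<in> M \<and> (\<exists>r\<in>M. ?c v = Suc r \<and> (r, v) \<in> ?R)" if "v < n" "?c v \<noteq> 0" for v
  proof (cases "v = u \<or> v < n \<and> v \<in> M \<and> (u, v) \<in> E \<and> c v = 0")
    case True
    then have "v \<in> M" using uM by blast
    moreover have "(r, v) \<in> ?R"
    proof (cases "v = u")
      case False
      then have "(u, v) \<in> E \<inter> M \<times> M"
        using True uM by blast
      with r(3) show ?thesis by (rule rtrancl_into_rtrancl)
    qed (use r in simp)
    ultimately show ?thesis
      using True r by auto
  next
    case False
    then show ?thesis using i1[of v] that by auto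
  qed
  have 2: "?c v \<noteq> 0" if "v < n" "?p v \<noteq> 0" for v
    using that i2[of v] cu by (auto split: if_splits)
  have 3: "?c v = ?c w" if w: "w < n" "v \<in> M" "?p w \<noteq> 0" "(w, v) \<in> E" for w v
  proof (cases "w = u")
    case True
    then have "v < n" "v \<noteq> u"
      using w M E(2) by (auto simp: irrefl_def)
    then show ?thesis
      using nbr[of v] w True by auto
  next
    case False
    then have pw: "p w \<noteq> 0" using w(3) by simp
    then have eq: "c v = c w" "c w \<noteq> 0"
      using i3[OF w(1,2) _ w(4)] i2[OF w(1)] by auto
    have "?c w = c w"
      using False eq by auto
    moreover have "?c v = c v"
    proof (cases "v = u")
      case True
      then show ?thesis using eq l by simp
    qed (use eq in auto)
    ultimately show ?thesis using eq by simp
  qed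
  \<comment> \<open>A vertex that was labelled and unmarked before shows that \<open>u\<close> is no
    new root, so the fourth condition gives both the same label.\<close>
  have l_label: "?c v = l" if "v < n" "?c v \<noteq> 0" "?p v = 0" for v
  proof (rule ccontr)
    assume neq: "?c v \<noteq> l"
    then have "v \<noteq> u" "?c v = c v" by auto
    moreover from this have "c v \<noteq> 0" "p v = 0" using that by auto
    moreover from this have "c u \<noteq> 0" using u(2) that(1) by blast
    ultimately show False
      using i4[OF u(1) that(1)] pu neq l by simp
  qed
  have 5: "Suc k \<le> card {v. v < n \<and> ?p v \<noteq> 0} \<or> (\<forall>v\<in>M. ?p v \<noteq> 0)"
  proof -
    have "{v. v < n \<and> ?p v \<noteq> 0} = insert u {v. v < n \<and> p v \<noteq> 0}"
      using u(1) by auto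
    then have "card {v. v < n \<and> ?p v \<noteq> 0} = Suc (card {v. v < n \<and> p v \<noteq> 0})"
      using pu by simp
    then show ?thesis using i5 by auto
  qed
  have 4: "?c v = ?c w" if "v < n" "w < n" "?c v \<noteq> 0" "?p v = 0" "?c w \<noteq> 0" "?p w = 0" for v w
    using l_label[OF that(1,3,4)] l_label[OF that(2,5,6)] by (rule trans[OF _ sym])
  show ?thesis
    unfolding partial_labelling_def
  proof (intro conjI)
    show "\<forall>v<n. ?c v \<noteq> 0 \<longrightarrow> v \<in> M \<and> (\<exists>r\<in>M. ?c v = Suc r \<and> (r, v) \<in> ?R)"
      by (intro allI impI 1)
    show "\<forall>v<n. ?p v \<noteq> 0 \<longrightarrow> ?c v \<noteq> 0"
      by (intro allI impI 2)
    show "\<forall>w<n. \<forall>v\<in>M. ?p w \<noteq> 0 \<longrightarrow> (w, v) \<in> E \<longrightarrow> ?c v = ?c w"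
      by (intro allI ballI impI 3)
    show "\<forall>v<n. \<forall>w<n. ?c v \<noteq> 0 \<longrightarrow> ?p v = 0 \<longrightarrow> ?c w \<noteq> 0 \<longrightarrow> ?p w = 0 \<longrightarrow> ?c v = ?c w"
      by (intro allI impI 4)
  qed (rule 5)
qed

text \<open>Covers the idle rounds: the number of rounds is always \<open>n\<close>, even if
  \<open>M\<close> is exhausted earlier.\<close>

lemma partial_labelling_finished:
  assumes inv: "partial_labelling n M E k c p" and M: "M \<subseteq> {..<n}"
    and "\<And>v. v < n \<Longrightarrow> c v \<noteq> 0 \<Longrightarrow> p v \<noteq> 0" and "\<And>v. v \<in> M \<Longrightarrow> c v \<noteq> 0"
  shows "partial_labelling n M E (Suc k) c p"
proof -
  have "\<forall>v\<in>M. p v \<noteq> 0"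
    using assms(2-4) by auto
  then show ?thesis
    using inv unfolding partial_labelling_def by meson
qed

text \<open>After \<open>n\<close> rounds the fifth condition leaves no room among \<open>n\<close>
  vertices for an unmarked one in \<open>M\<close>.\<close>

lemma partial_labelling_marked:
  assumes inv: "partial_labelling n M E n c p" and M: "M \<subseteq> {..<n}" and w: "w \<in> M"
  shows "p w \<noteq> 0"
proof (rule ccontr)
  assume "\<not> p w \<noteq> 0"
  then have "{v. v < n \<and> p v \<noteq> 0} \<subseteq> {..<n} - {w}"
    by auto
  then have "card {v. v < n \<and> p v \<noteq> 0} \<le> card ({..<n} - {w})"
    by (intro card_mono) auto
  moreover have "w < n"
    using w M by blast
  ultimately have "card {v. v < n \<and> p v \<noteq> 0} < n"
    by simp
  moreover have "n \<le> card {v. v < n \<and> p v \<noteq> 0} \<or> (\<forall>v\<in>M. p v \<noteq> 0)"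
    using inv unfolding partial_labelling_def by blast
  ultimately show False
    using w \<open>\<not> p w \<noteq> 0\<close> by auto
qed

lemma partial_labelling_label:
  assumes inv: "partial_labelling n M E n c p" and M: "M \<subseteq> {..<n}" and v: "v < n"
  shows "c v \<noteq> 0 \<longleftrightarrow> v \<in> M"
proof
  show "c v \<noteq> 0 \<Longrightarrow> v \<in> M"
    using inv v unfolding partial_labelling_def by blast
  show "v \<in> M \<Longrightarrow> c v \<noteq> 0"
    using partial_labelling_marked[OF inv M] inv v unfolding partial_labelling_def by blast
qed

text \<open>Once all of \<open>M\<close> is marked, labels are constant along arcs by the third
  condition. Conversely a label names a root to which its vertices are connected.\<close>

lemma partial_labelling_complete:
  assumes inv: "partial_labelling n M E n c p" and M: "M \<subseteq> {..<n}"
    and uv: "u \<in> M" "v \<in> M" and E: "sym E"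
  shows "c u = c v \<longleftrightarrow> (u, v) \<in> (E \<inter> M \<times> M)\<^sup>*"
proof
  let ?R = "(E \<inter> M \<times> M)\<^sup>*"
  note marked = partial_labelling_marked[OF inv M]
  have root: "\<exists>r. c w = Suc r \<and> (r, w) \<in> ?R" if "w \<in> M" for w
  proof -
    have "w < n" using that M by blast
    then have "c w \<noteq> 0" using partial_labelling_label[OF inv M] that by blast
    then show ?thesis using inv \<open>w < n\<close> unfolding partial_labelling_def by blast
  qed
  show "c u = c v" if "(u, v) \<in> ?R"
    using that
  proof induction
    case (step y z)
    then have "y < n" "z \<in> M" "(y, z) \<in> E" "p y \<noteq> 0"
      using marked[of y] M by auto
    then have "c z = c y"
      using inv unfolding partial_labelling_def by blast
    then show ?case using step by simp
  qed simp
  have "sym (E \<inter> M \<times> M)"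
    using E by (auto simp: sym_def)
  then have sym: "sym ?R"
    by (rule sym_rtrancl)
  show "(u, v) \<in> ?R" if "c u = c v"
  proof -
    obtain r where "c u = Suc r" "(r, u) \<in> ?R" using root uv by blast
    moreover obtain r' where "c v = Suc r'" "(r', v) \<in> ?R" using root uv by blast
    ultimately have "(u, r) \<in> ?R" "(r, v) \<in> ?R"
      using that symD[OF sym] by auto
    then show ?thesis by (rule rtrancl_trans)
  qed
qed

lemma partial_labelling_zero:
  "partial_labelling n M E 0 (\<lambda>_. 0) (\<lambda>_. 0)"
  by (simp add: partial_labelling_def)

text \<open>The number is stored plus one, so that 0 can mean that nothing was found. Without a hit
  the old content stays, so of two consecutive selections the second has priority.\<close>

definition select_prog :: "expr \<Rightarrow> prog" where
  "select_prog e = For ''v'' (If_nz e (Upd ''sel'' (Const 0) (Add (Var ''v'') (Const 1))) Pass)"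

lemma select_prog_correct:
  assumes n: "s ''n'' 0 = n"
    and test: "\<And>k r. k < n \<Longrightarrow> r ''v'' 0 = k \<Longrightarrow> (\<And>a. a \<noteq> ''v'' \<Longrightarrow> a \<noteq> ''sel'' \<Longrightarrow> r a = s a) \<Longrightarrow>
      val r e \<noteq> 0 \<longleftrightarrow> Q k"
  shows "(\<forall>k<n. \<not> Q k) \<and> exec (select_prog e) s ''sel'' 0 = s ''sel'' 0 \<or>
    (\<exists>k<n. Q k \<and> exec (select_prog e) s ''sel'' 0 = Suc k)"
  unfolding select_prog_def
proof (rule exec_For[where P = "\<lambda>m r. (\<forall>k<m. \<not> Q k) \<and> r ''sel'' 0 = s ''sel'' 0 \<or>
    (\<exists>k<m. Q k \<and> r ''sel'' 0 = Suc k)"])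
  let ?c = "If_nz e (Upd ''sel'' (Const 0) (Add (Var ''v'') (Const 1))) Pass"
  fix k r
  assume k: "k < n" "r ''v'' 0 = k" and frame: "\<And>a. a \<noteq> ''v'' \<Longrightarrow> a \<notin> writes ?c \<Longrightarrow> r a = s a"
    and IH: "(\<forall>m<k. \<not> Q m) \<and> r ''sel'' 0 = s ''sel'' 0 \<or> (\<exists>m<k. Q m \<and> r ''sel'' 0 = Suc m)"
  have "val r e \<noteq> 0 \<longleftrightarrow> Q k"
    using test[of k r] k frame by simp
  then have "exec ?c r ''sel'' 0 = (if Q k then Suc k else r ''sel'' 0)"
    using frame[of "''n''"] n k by simp
  then show "(\<forall>m<Suc k. \<not> Q m) \<and> exec ?c r ''sel'' 0 = s ''sel'' 0 \<or>
      (\<exists>m<Suc k. Q m \<and> exec ?c r ''sel'' 0 = Suc m)"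
    using IH by (auto simp: less_Suc_eq)
qed (use n in auto)

definition selected :: expr where "selected = Sub (Var ''sel'') (Const 1)"

definition propagate_prog :: prog where
  "propagate_prog = For ''v'' (If_nz (Mul (Mul (entry ''M2'' ''v'') (edge selected (Var ''v''))) (neg (entry ''component'' ''v'')))
     (Upd ''component'' (Var ''v'') (Cell ''component'' selected)) Pass)"

lemma propagate_prog_correct:
  assumes g: "graph_store n E s" and M: "represents n (s ''M2'') M" and u: "s ''sel'' 0 = Suc u" "u < n"
    and c: "s ''component'' u \<noteq> 0" "s ''component'' u \<le> n"
  shows "exec propagate_prog s ''component'' = (\<lambda>v. if v < n \<and> v \<in> M \<and> (u, v) \<in> E \<and> s ''component'' v = 0
    then s ''component'' u else s ''component'' v)"
proof -
  let ?c = "If_nz (Mul (Mul (entry ''M2'' ''v'') (edge selected (Var ''v''))) (neg (entry ''component'' ''v'')))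
     (Upd ''component'' (Var ''v'') (Cell ''component'' selected)) Pass"
  let ?h = "\<lambda>v. if v \<in> M \<and> (u, v) \<in> E \<and> s ''component'' v = 0
    then s ''component'' u else s ''component'' v"
  have n: "s ''n'' 0 = n"
    using g by (simp add: graph_store_def)
  have "exec propagate_prog s ''component'' = (\<lambda>v. if v < n then ?h v else s ''component'' v)"
    unfolding propagate_prog_def
  proof (rule exec_For_pointwise)
    fix k r
    assume k: "k < n" "r ''v'' 0 = k" and frame: "\<And>a. a \<noteq> ''v'' \<Longrightarrow> a \<notin> writes ?c \<Longrightarrow> r a = s a"
      and r: "r ''component'' = (\<lambda>j. if j < k then ?h j else s ''component'' j)"
    have sel: "val r selected = u"
      using frame[of "''sel''"] u by (simp add: selected_def)
    have "graph_store n E r"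
      using g by (rule graph_store_frame) (use frame in auto)
    then have "val r (edge selected (Var ''v'')) = of_bool ((u, k) \<in> E)"
      using sel u k by (subst val_edge) auto
    moreover have "val r (entry ''M2'' ''v'') = of_bool (k \<in> M)"
      using frame[of "''M2''"] k M by (simp add: entry_def represents_def)
    moreover have "val r (neg (entry ''component'' ''v'')) \<noteq> 0 \<longleftrightarrow> s ''component'' k = 0"
      using r k by (cases "s ''component'' k") (simp_all add: entry_def neg_def)
    \<comment> \<open>The loop changes only cells containing 0, so the label being copied stays
      intact.\<close>
    moreover have "r ''component'' u = s ''component'' u"
      using r c by simp
    ultimately show "exec ?c r ''component'' = (r ''component'')(k := ?h k)"
      using sel k c frame[of "''n''"] n r by (auto simp: fun_eq_iff)
  qed (use n in auto)
  then show ?thesis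
    by (simp only: fun_eq_iff) auto
qed

text \<open>The second selection overrides the first: a new root is opened only if no labelled
  vertex awaits processing, as \<open>partial_labelling_step\<close> demands. A round contains only
  unnested loops, hence is linear.\<close>

definition component_prog :: prog where
  "component_prog = For ''i'' (Upd ''sel'' (Const 0) (Const 0) ;;
     select_prog (Mul (entry ''M2'' ''v'') (neg (entry ''component'' ''v''))) ;;
     select_prog (Mul (entry ''component'' ''v'') (neg (entry ''done'' ''v''))) ;;
     If_nz (Var ''sel'')
       (If_nz (Cell ''component'' selected) Pass (Upd ''component'' selected (Var ''sel'')) ;;
        Upd ''done'' selected (Const 1) ;;
        propagate_prog)
       Pass)"

lemma component_prog_correct:
  assumes g: "graph_store n E s" and M: "represents n (s ''M2'') M" "M \<subseteq> {..<n}"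
    and E: "sym E" "irrefl E" and zero: "s ''component'' = (\<lambda>_. 0)" "s ''done'' = (\<lambda>_. 0)"
  shows "partial_labelling n M E n (exec component_prog s ''component'') (exec component_prog s ''done'')"
  unfolding component_prog_def
proof (rule exec_For[where P = "\<lambda>k r. partial_labelling n M E k (r ''component'') (r ''done'')"])
  let ?s1 = "select_prog (Mul (entry ''M2'' ''v'') (neg (entry ''component'' ''v'')))"
  let ?s2 = "select_prog (Mul (entry ''component'' ''v'') (neg (entry ''done'' ''v'')))"
  let ?label = "If_nz (Cell ''component'' selected) Pass (Upd ''component'' selected (Var ''sel''))"
  let ?mark = "Upd ''done'' selected (Const 1)"
  let ?c = "Upd ''sel'' (Const 0) (Const 0) ;; ?s1 ;; ?s2 ;;
     If_nz (Var ''sel'') (?label ;; ?mark ;; propagate_prog) Pass"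
  have n: "s ''n'' 0 = n" "1 \<le> n"
    using g by (simp_all add: graph_store_def)
  fix k r
  assume k: "k < n" and frame: "\<And>a. a \<noteq> ''i'' \<Longrightarrow> a \<notin> writes ?c \<Longrightarrow> r a = s a"
    and inv: "partial_labelling n M E k (r ''component'') (r ''done'')"
  define c p where "c = r ''component''" and "p = r ''done''"
  have fr: "a \<notin> {''i'', ''sel'', ''v'', ''component'', ''done''} \<Longrightarrow> r a = s a" for a
    using frame by (simp add: select_prog_def propagate_prog_def)
  define r1 where "r1 = exec (Upd ''sel'' (Const 0) (Const 0)) r"
  define r2 where "r2 = exec ?s1 r1"
  define r3 where "r3 = exec ?s2 r2"
  have r1: "a \<noteq> ''sel'' \<Longrightarrow> r1 a = r a" "r1 ''sel'' 0 = 0" for a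
    by (simp_all add: r1_def)
  have r2: "a \<notin> {''sel'', ''v''} \<Longrightarrow> r2 a = r a" for a
    unfolding r2_def using r1(1)[of a] by (subst exec_frame) (auto simp: select_prog_def)
  have r3: "a \<notin> {''sel'', ''v''} \<Longrightarrow> r3 a = r a" for a
    unfolding r3_def using r2[of a] by (subst exec_frame) (auto simp: select_prog_def)
  have sel1: "(\<forall>m<n. \<not> (m \<in> M \<and> c m = 0)) \<and> r2 ''sel'' 0 = r1 ''sel'' 0 \<or>
      (\<exists>m<n. (m \<in> M \<and> c m = 0) \<and> r2 ''sel'' 0 = Suc m)"
    unfolding r2_def
  proof (rule select_prog_correct)
    show "r1 ''n'' 0 = n" using r1 fr n by simp
    fix m t
    assume m: "m < n" "t ''v'' 0 = m" and t: "\<And>a. a \<noteq> ''v'' \<Longrightarrow> a \<noteq> ''sel'' \<Longrightarrow> t a = r1 a"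
    show "val t (Mul (entry ''M2'' ''v'') (neg (entry ''component'' ''v''))) \<noteq> 0 \<longleftrightarrow> m \<in> M \<and> c m = 0"
      using t[of "''M2''"] t[of "''component''"] r1(1)[of "''M2''"] r1(1)[of "''component''"] fr[of "''M2''"] m M(1)
      by (auto simp: entry_def neg_def c_def represents_def)
  qed
  have sel2: "(\<forall>m<n. \<not> (c m \<noteq> 0 \<and> p m = 0)) \<and> r3 ''sel'' 0 = r2 ''sel'' 0 \<or>
      (\<exists>m<n. (c m \<noteq> 0 \<and> p m = 0) \<and> r3 ''sel'' 0 = Suc m)"
    unfolding r3_def
  proof (rule select_prog_correct)
    show "r2 ''n'' 0 = n" using r2 fr n by simp
    fix m t
    assume m: "m < n" "t ''v'' 0 = m" and t: "\<And>a. a \<noteq> ''v'' \<Longrightarrow> a \<noteq> ''sel'' \<Longrightarrow> t a = r2 a"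
    show "val t (Mul (entry ''component'' ''v'') (neg (entry ''done'' ''v''))) \<noteq> 0 \<longleftrightarrow> c m \<noteq> 0 \<and> p m = 0"
      using t[of "''done''"] t[of "''component''"] r2[of "''done''"] r2[of "''component''"] m
      by (auto simp: entry_def neg_def c_def p_def)
  qed
  have unfold: "exec ?c r = (if r3 ''sel'' 0 \<noteq> 0 then exec (?label ;; ?mark ;; propagate_prog) r3 else r3)"
    by (simp add: r1_def[symmetric] r2_def[symmetric] r3_def[symmetric] del: exec.simps(2))
  show "partial_labelling n M E (Suc k) (exec ?c r ''component'') (exec ?c r ''done'')"
  proof (cases "r3 ''sel'' 0 = 0")
    case True
    then have "\<forall>m<n. \<not> (c m \<noteq> 0 \<and> p m = 0)" "\<forall>m<n. \<not> (m \<in> M \<and> c m = 0)"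
      using sel1 sel2 by auto
    then have "partial_labelling n M E (Suc k) c p"
      using inv M(2) unfolding c_def[symmetric] p_def[symmetric]
      by (intro partial_labelling_finished) auto
    then show ?thesis
      unfolding unfold using True r3 by (simp add: c_def p_def)
  next
    case False
    then obtain u where u: "r3 ''sel'' 0 = Suc u" "u < n"
        "c u \<noteq> 0 \<and> p u = 0 \<or> u \<in> M \<and> c u = 0 \<and> (\<forall>v<n. c v \<noteq> 0 \<longrightarrow> p v \<noteq> 0)"
    proof (cases "\<exists>m<n. c m \<noteq> 0 \<and> p m = 0")
      case True
      then obtain m where "m < n" "c m \<noteq> 0 \<and> p m = 0" "r3 ''sel'' 0 = Suc m"
        using sel2 by blast
      then show ?thesis using that[of m] by blast
    next
      case none: False
      then have "r2 ''sel'' 0 \<noteq> r1 ''sel'' 0"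
        using sel2 False r1(2) by auto
      then obtain m where m: "m < n" "m \<in> M" "c m = 0" "r2 ''sel'' 0 = Suc m"
        using sel1 by blast
      have eq: "r3 ''sel'' 0 = r2 ''sel'' 0"
        using sel2 none by meson
      have rest: "\<forall>v<n. c v \<noteq> 0 \<longrightarrow> p v \<noteq> 0"
        using none by auto
      show ?thesis
        by (rule that[of m]) (simp add: eq m, rule m, intro disjI2 conjI m rest)
    qed
    define l where "l = (if c u \<noteq> 0 then c u else Suc u)"
    \<comment> \<open>Labels are successors of vertex numbers, hence at most \<open>n\<close> and
      unaffected by the cap.\<close>
    have "\<forall>v<n. c v \<noteq> 0 \<longrightarrow> v \<in> M \<and> (\<exists>r\<in>M. c v = Suc r \<and> (r, v) \<in> (E \<inter> M \<times> M)\<^sup>*)"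
      using inv unfolding c_def partial_labelling_def by (rule conjunct1)
    then have "c u \<noteq> 0 \<Longrightarrow> \<exists>r<n. c u = Suc r"
      using u(2) M(2) by (meson lessThan_iff subsetD)
    then have l: "l \<noteq> 0" "l \<le> n"
      using u(2) M(2) by (auto simp: l_def Suc_le_eq)
    have nr3: "r3 ''n'' 0 = n" "r3 ''component'' = c" "r3 ''done'' = p"
      using r3 fr n by (simp_all add: c_def p_def)
    define r4 where "r4 = exec (?label ;; ?mark) r3"
    have r4: "r4 ''component'' = c(u := l)" "r4 ''done'' = p(u := 1)"
      "a \<notin> {''component'', ''done''} \<Longrightarrow> r4 a = r3 a" for a
      using u(1,2) nr3 n l by (auto simp: r4_def selected_def l_def)
    have g4: "graph_store n E r4"
      using g by (rule graph_store_frame) (use r4(3) r3 fr in auto)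
    have M4: "represents n (r4 ''M2'') M"
      using M(1) r4(3)[of "''M2''"] r3[of "''M2''"] fr[of "''M2''"] by simp
    have "r4 ''sel'' 0 = Suc u" "r4 ''component'' u \<noteq> 0" "r4 ''component'' u \<le> n"
      using u(1) r4(3)[of "''sel''"] l unfolding r4(1) by simp_all
    note labels = propagate_prog_correct[OF g4 M4 this(1) u(2) this(2,3), unfolded r4(1)]
    have "exec propagate_prog r4 ''done'' = r4 ''done''"
      by (rule exec_frame) (simp add: propagate_prog_def)
    moreover have "exec (?label ;; ?mark ;; propagate_prog) r3 = exec propagate_prog r4"
      unfolding r4_def by (simp only: exec.simps(3))
    moreover have "exec propagate_prog r4 ''component'' =
        (\<lambda>v. if v = u \<or> v < n \<and> v \<in> M \<and> (u, v) \<in> E \<and> c v = 0 then l else c v)"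
      unfolding labels using l by (auto simp: fun_eq_iff)
    ultimately show ?thesis
      unfolding unfold using False r4(2)
        partial_labelling_step[OF inv[folded c_def p_def] M(2) E u(2,3) l_def] by simp
  qed
qed (use zero partial_labelling_zero g in \<open>auto simp: select_prog_def propagate_prog_def graph_store_def\<close>)

section \<open>The whole algorithm and its bounds\<close>

definition generating_prog :: prog where
  "generating_prog = centre_nbhd_prog ;; closed_nbhd_prog ''Y'' ''cy'' ;; M1_prog ;; f_prog ;;
     M2_prog ;; component_prog ;; choose_prog ;; closed_nbhd_prog ''S'' ''dom'' ;; answer_prog"

lemmas prog_defs = centre_nbhd_prog_def closed_nbhd_prog_def M1_prog_def f_prog_def M2_prog_def
  component_prog_def select_prog_def propagate_prog_def choose_prog_def answer_prog_def

text \<open>60 is a generous round bound; the most expensive expression is the capped one assigned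
  to \<open>M2\<close>, of cost 42.\<close>

lemma admissible_generating_prog: "admissible 60 generating_prog"
  by (simp add: generating_prog_def prog_defs entry_def edge_def neg_def same_def key_def
      selected_def capped_def)

lemma nesting_generating_prog: "nesting generating_prog = 2"
  by (simp add: generating_prog_def prog_defs)

lemma graph_store_input:
  assumes "1 \<le> n"
  shows "graph_store n (parcs G) (input_store n G x Y)"
proof -
  have "u * n + v < n * n" if "u < n" "v < n" for u v
  proof -
    have "u * n + v < Suc u * n"
      using that by simp
    also have "\<dots> \<le> n * n"
      using that by (intro mult_le_mono1) simp
    finally show ?thesis .
  qed
  then show ?thesis
    using assms by (simp add: graph_store_def input_store_def)
qed

lemma input_store_le:
  assumes "1 \<le> n" "x < n"
  shows "input_store n G x Y a j \<le> n"
  using assms by (auto simp: input_store_def)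

lemma generating_prog_correct:
  assumes "chordal_star G x Y" and V: "pverts G = {..<n}"
  shows "correct_output G {x} Y (exec generating_prog (input_store n G x Y))"
proof -
  interpret chordal_star G x Y by fact
  let ?E = "parcs G"
  have x: "x < n" "1 \<le> n"
    using star_verts(1) V by auto
  define s0 where "s0 = input_store n G x Y"
  define s1 where "s1 = exec centre_nbhd_prog s0"
  define s2 where "s2 = exec (closed_nbhd_prog ''Y'' ''cy'') s1"
  define s3 where "s3 = exec M1_prog s2"
  define s4 where "s4 = exec f_prog s3"
  define s5 where "s5 = exec M2_prog s4"
  define s6 where "s6 = exec component_prog s5"
  define s7 where "s7 = exec choose_prog s6"
  define s8 where "s8 = exec (closed_nbhd_prog ''S'' ''dom'') s7"
  define s9 where "s9 = exec answer_prog s8"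
  have final: "exec generating_prog (input_store n G x Y) = s9"
    by (simp only: generating_prog_def exec.simps(3) s0_def s1_def s2_def s3_def s4_def s5_def
        s6_def s7_def s8_def s9_def)
  have fr1: "a \<notin> {''v'', ''cx''} \<Longrightarrow> s1 a = s0 a" for a
    unfolding s1_def by (rule exec_frame) (simp add: prog_defs)
  have fr2: "a \<notin> {''u'', ''v'', ''cy''} \<Longrightarrow> s2 a = s1 a" for a
    unfolding s2_def by (rule exec_frame) (simp add: prog_defs)
  have fr3: "a \<notin> {''v'', ''M1''} \<Longrightarrow> s3 a = s2 a" for a
    unfolding s3_def by (rule exec_frame) (simp add: prog_defs)
  have fr4: "a \<notin> {''u'', ''v'', ''f''} \<Longrightarrow> s4 a = s3 a" for a
    unfolding s4_def by (rule exec_frame) (simp add: prog_defs)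
  have fr5: "a \<notin> {''v'', ''M2''} \<Longrightarrow> s5 a = s4 a" for a
    unfolding s5_def by (rule exec_frame) (simp add: prog_defs)
  have fr6: "a \<notin> {''i'', ''v'', ''sel'', ''component'', ''done''} \<Longrightarrow> s6 a = s5 a" for a
    unfolding s6_def by (rule exec_frame) (simp add: prog_defs)
  have fr7: "a \<notin> {''u'', ''v'', ''S''} \<Longrightarrow> s7 a = s6 a" for a
    unfolding s7_def by (rule exec_frame) (simp add: prog_defs)
  have fr8: "a \<notin> {''u'', ''v'', ''dom''} \<Longrightarrow> s8 a = s7 a" for a
    unfolding s8_def by (rule exec_frame) (simp add: prog_defs)
  have fr9: "a \<notin> {''v'', ''answer''} \<Longrightarrow> s9 a = s8 a" for a
    unfolding s9_def by (rule exec_frame) (simp add: prog_defs)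
  have g0: "graph_store n ?E s0"
    unfolding s0_def by (rule graph_store_input[OF x(2)])
  have n0: "s0 ''n'' 0 = n"
    using g0 by (simp add: graph_store_def)
  have g1: "graph_store n ?E s1"
    using g0 by (rule graph_store_frame) (simp_all add: fr1)
  have g3: "graph_store n ?E s3"
    using g0 by (rule graph_store_frame) (simp_all add: fr1 fr2 fr3)
  have g5: "graph_store n ?E s5"
    using g0 by (rule graph_store_frame) (simp_all add: fr1 fr2 fr3 fr4 fr5)
  have g7: "graph_store n ?E s7"
    using g0 by (rule graph_store_frame) (simp_all add: fr1 fr2 fr3 fr4 fr5 fr6 fr7)
  have cx: "represents n (s1 ''cx'') near_x"
    unfolding s1_def near_x_def
    by (rule centre_nbhd_prog_correct[OF g0 _ x(1)]) (simp add: s0_def input_store_def)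
  have "represents n (s1 ''Y'') Y"
    by (simp add: fr1 s0_def input_store_def represents_def)
  from closed_nbhd_prog_correct[OF g1 this, of "''cy''"]
  have "represents n (s2 ''cy'') {v. v \<in> Y \<or> (\<exists>u<n. u \<in> Y \<and> (v, u) \<in> ?E)}"
    by (simp add: s2_def)
  moreover have "{v. v \<in> Y \<or> (\<exists>u<n. u \<in> Y \<and> (v, u) \<in> ?E)} = near_Y"
    using star_verts(2) V unfolding near_Y_def by blast
  ultimately have cy: "represents n (s2 ''cy'') near_Y"
    by simp
  have m1: "represents n (s3 ''M1'') M1s"
    unfolding s3_def M1_eq
    by (rule M1_prog_correct) (use cx cy n0 x(2) in \<open>simp_all add: fr1 fr2\<close>)
  have f_card: "s4 ''f'' v = card (f v)" if "v < n" for v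
  proof -
    have "s4 ''f'' v = card {u. u < n \<and> u \<in> M1s \<and> (v, u) \<in> ?E}"
      unfolding s4_def
      by (rule f_prog_correct[OF g3 m1 _ that]) (simp add: fr1 fr2 fr3 s0_def input_store_def)
    also have "{u. u < n \<and> u \<in> M1s \<and> (v, u) \<in> ?E} = f v"
      using f_eq[of v] M1_subset V that by auto
    finally show ?thesis .
  qed
  have "represents n (s5 ''M2'') {v. v \<notin> near_x \<union> near_Y \<and> s4 ''f'' v \<noteq> 0}"
    unfolding s5_def
    by (rule M2_prog_correct[OF _ x(2)]) (use cx cy n0 in \<open>simp_all add: fr1 fr2 fr3 fr4\<close>)
  moreover have "v \<in> {v. v \<notin> near_x \<union> near_Y \<and> s4 ''f'' v \<noteq> 0} \<longleftrightarrow> v \<in> M2s" if "v < n" for v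
  proof -
    have "s4 ''f'' v \<noteq> 0 \<longleftrightarrow> f v \<noteq> {}"
      using f_card[OF that] finite_f[of v] by simp
    also have "\<dots> \<longleftrightarrow> (\<exists>z\<in>M1s. (v, z) \<in> ?E)"
      using f_eq[of v] V that by auto
    finally show ?thesis
      unfolding M2_eq by simp
  qed
  ultimately have m2: "represents n (s5 ''M2'') M2s"
    by (simp add: represents_def)
  have M2n: "M2s \<subseteq> {..<n}"
    using M2_subset V by simp
  have E: "sym ?E" "irrefl ?E"
    using parcs_sym parcs_irrefl by (auto simp: sym_def irrefl_def)
  have lab: "partial_labelling n M2s ?E n (s6 ''component'') (s6 ''done'')"
    unfolding s6_def
    by (rule component_prog_correct[OF g5 m2 M2n E])
      (simp_all add: fr1 fr2 fr3 fr4 fr5 s0_def input_store_def)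
  have comp: "s6 ''component'' u = s6 ''component'' v \<longleftrightarrow> (u, v) \<in> link\<^sup>*" if "u \<in> M2s" "v \<in> M2s" for u v
    unfolding link_def by (rule partial_labelling_complete[OF lab M2n that E(1)])
  define key where "key v = card (f v) * n + v" for v
  define S where "S = {v \<in> M2s. \<forall>u. (v, u) \<in> link\<^sup>* \<longrightarrow> key u \<le> key v}"
  have "represents n (s7 ''S'') {v \<in> M2s. \<forall>u<n. s6 ''component'' u = s6 ''component'' v \<longrightarrow>
      s6 ''f'' u * n + u \<le> s6 ''f'' v * n + v}"
    unfolding s7_def
    by (rule choose_prog_correct[OF _ x(2)]) (use m2 n0 in \<open>simp_all add: fr1 fr2 fr3 fr4 fr5 fr6\<close>)
  moreover have "{v \<in> M2s. \<forall>u<n. s6 ''component'' u = s6 ''component'' v \<longrightarrow>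
      s6 ''f'' u * n + u \<le> s6 ''f'' v * n + v} = S"
  proof -
    have f6: "s6 ''f'' u * n + u = key u" if "u < n" for u
      using f_card[OF that] by (simp add: fr5 fr6 key_def)
    \<comment> \<open>Exactly the vertices of \<open>M2\<close> have a non-zero label, so sharing
      the label of \<open>v\<close> puts \<open>u\<close> into \<open>M2\<close>.\<close>
    have same: "u < n \<and> s6 ''component'' u = s6 ''component'' v \<longleftrightarrow> (v, u) \<in> link\<^sup>*" if v: "v \<in> M2s" for u v
    proof
      assume u: "u < n \<and> s6 ''component'' u = s6 ''component'' v"
      have "v < n" using v M2n by blast
      then have "u \<in> M2s"
        using partial_labelling_label[OF lab M2n, of u] partial_labelling_label[OF lab M2n, of v] u v by simp
      then show "(v, u) \<in> link\<^sup>*" using comp[OF v, of u] u by simp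
    next
      assume vu: "(v, u) \<in> link\<^sup>*"
      then have "u \<in> M2s" using link_closed v by blast
      then show "u < n \<and> s6 ''component'' u = s6 ''component'' v"
        using comp[OF v, of u] vu M2n by auto
    qed
    have "(\<forall>u<n. s6 ''component'' u = s6 ''component'' v \<longrightarrow> s6 ''f'' u * n + u \<le> s6 ''f'' v * n + v)
        \<longleftrightarrow> (\<forall>u. (v, u) \<in> link\<^sup>* \<longrightarrow> key u \<le> key v)" if v: "v \<in> M2s" for v
    proof -
      have "v < n" using v M2n by blast
      then have "(\<forall>u<n. s6 ''component'' u = s6 ''component'' v \<longrightarrow> s6 ''f'' u * n + u \<le> s6 ''f'' v * n + v)
          \<longleftrightarrow> (\<forall>u. u < n \<and> s6 ''component'' u = s6 ''component'' v \<longrightarrow> key u \<le> key v)"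
        using f6 by auto
      then show ?thesis
        by (simp only: same[OF v])
    qed
    then show ?thesis
      unfolding S_def by blast
  qed
  ultimately have repS: "represents n (s7 ''S'') S"
    by simp
  \<comment> \<open>As \<open>v < n\<close>, division by \<open>n\<close> recovers both parts of the
    key; this yields its injectivity and its monotonicity in \<open>card (f v)\<close>.\<close>
  have div: "key v div n = card (f v)" "key v mod n = v" if "v \<in> M2s" for v
    using that M2n by (auto simp: key_def)
  have chosen: "chosen_vertices G {x} Y S"
    unfolding S_def
  proof (rule chosen_vertices_max_key)
    show "inj_on key M2s"
      by (rule inj_on_inverseI[of _ "\<lambda>k. k mod n"]) (rule div)
    show "card (f u) \<le> card (f v)" if "u \<in> M2s" "v \<in> M2s" "key u \<le> key v" for u v
      using div_le_mono[OF that(3), of n] div that by simp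
  qed
  have S_sub: "S \<subseteq> pverts G"
    using M2_subset unfolding S_def by blast
  have "represents n (s8 ''dom'') {v. v \<in> S \<or> (\<exists>u<n. u \<in> S \<and> (v, u) \<in> ?E)}"
    unfolding s8_def by (rule closed_nbhd_prog_correct[OF g7 repS]) simp_all
  moreover have "{v. v \<in> S \<or> (\<exists>u<n. u \<in> S \<and> (v, u) \<in> ?E)} = closed_nbhd G 1 S"
    using S_sub V unfolding closed_nbhd_one[OF S_sub] by blast
  ultimately have dom: "represents n (s8 ''dom'') (closed_nbhd G 1 S)"
    by simp
  have "s9 ''answer'' 0 = of_bool (\<forall>v<n. v \<in> M1s \<longrightarrow> v \<in> closed_nbhd G 1 S)"
    unfolding s9_def
    by (rule answer_prog_correct)
      (use m1 dom n0 x(2) in \<open>simp_all add: fr1 fr2 fr3 fr4 fr5 fr6 fr7 fr8\<close>)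
  moreover have "(\<forall>v<n. v \<in> M1s \<longrightarrow> v \<in> closed_nbhd G 1 S) \<longleftrightarrow> dominates_set G S M1s"
    using M1_subset V unfolding dominates_set_def by blast
  ultimately have answer: "s9 ''answer'' 0 = of_bool (dominates_set G S M1s)"
    by simp
  show ?thesis
    unfolding final correct_output_def
  proof (intro conjI ballI exI[of _ S])
    fix v assume "v \<in> pverts G"
    then have v: "v < n" using V by simp
    show "s9 ''M1'' v = of_bool (v \<in> M1s)"
      using m1 v by (simp add: fr4 fr5 fr6 fr7 fr8 fr9 represents_def)
    show "s9 ''M2'' v = of_bool (v \<in> M2s)"
      using m2 v by (simp add: fr6 fr7 fr8 fr9 represents_def)
    show "s9 ''S'' v = of_bool (v \<in> S)"
      using repS v by (simp add: fr8 fr9 represents_def)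
  next
    fix u v assume "u \<in> M2s" "v \<in> M2s"
    then show "(s9 ''component'' u = s9 ''component'' v) \<longleftrightarrow>
        (\<exists>C\<in>M2_components G {x} Y. u \<in> C \<and> v \<in> C)"
      using comp by (simp add: fr7 fr8 fr9 same_component_iff)
  next
    fix w assume "w \<in> M2s"
    then have "w < n" using M2n by blast
    then show "s9 ''f'' w = card (f w)"
      using f_card by (simp add: fr5 fr6 fr7 fr8 fr9)
  qed (rule chosen, rule answer)
qed

theorem mainTheorem2:
  shows "(\<forall>(G :: 'a pair_pre_digraph) x Y S.
            pair_graph G \<and> chordal G \<and> induced_complete_bipartite G {x} Y \<and>
            chosen_vertices G {x} Y S \<longrightarrow>
              (generating G {x} Y \<longleftrightarrow> dominates_set G S (M1 G {x} Y)))
       \<and> (\<exists>(P :: com) (T :: nat \<Rightarrow> nat) (b :: nat \<Rightarrow> nat).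
            (\<lambda>n. real (T n)) \<in> O(\<lambda>n. real n ^ 2) \<and>
            (\<lambda>n. real (b n)) \<in> O(\<lambda>n. ln (real n)) \<and>
            (\<forall>n (G :: nat pair_pre_digraph) x Y.
               pair_graph G \<and> pverts G = {..<n} \<and> chordal G \<and>
               induced_complete_bipartite G {x} Y \<longrightarrow>
                 (\<exists>t s. run (b n) P (input_store n G x Y) t s \<and> t \<le> T n \<and>
                        correct_output G {x} Y s)))"
proof (rule conjI, intro allI impI)
  fix G :: "'a pair_pre_digraph" and x Y S
  assume asm: "pair_graph G \<and> chordal G \<and> induced_complete_bipartite G {x} Y \<and> chosen_vertices G {x} Y S"
  then interpret chordal_star G x Y
    by (simp add: chordal_star_def chordal_star_axioms_def)
  show "generating G {x} Y \<longleftrightarrow> dominates_set G S (M1 G {x} Y)"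
    using asm generating_iff_dominates by blast
next
  show "\<exists>(P :: com) (T :: nat \<Rightarrow> nat) (b :: nat \<Rightarrow> nat).
      (\<lambda>n. real (T n)) \<in> O(\<lambda>n. real n ^ 2) \<and>
      (\<lambda>n. real (b n)) \<in> O(\<lambda>n. ln (real n)) \<and>
      (\<forall>n (G :: nat pair_pre_digraph) x Y.
         pair_graph G \<and> pverts G = {..<n} \<and> chordal G \<and>
         induced_complete_bipartite G {x} Y \<longrightarrow>
           (\<exists>t s. run (b n) P (input_store n G x Y) t s \<and> t \<le> T n \<and>
                  correct_output G {x} Y s))"
  \<comment> \<open>The word length uses the bound 60 on expression costs; the step bound is
    quadratic because loops are nested at most twice.\<close>
  proof (rule exI[of _ "compile generating_prog"], rule exI[of _ "\<lambda>n. steps n generating_prog"],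
      rule exI[of _ "word_length 60"], intro conjI allI impI)
    show "(\<lambda>n. real (steps n generating_prog)) \<in> O(\<lambda>n. real n ^ 2)"
      using steps_bigo[of generating_prog] unfolding nesting_generating_prog .
    show "(\<lambda>n. real (word_length 60 n)) \<in> O(\<lambda>n. ln (real n))"
      by (rule word_length_bigo)
  next
    fix n and G :: "nat pair_pre_digraph" and x Y
    assume asm: "pair_graph G \<and> pverts G = {..<n} \<and> chordal G \<and> induced_complete_bipartite G {x} Y"
    then have star: "chordal_star G x Y"
      by (simp add: chordal_star_def chordal_star_axioms_def)
    then have "x < n"
      using chordal_star.star_verts(1) asm by fastforce
    let ?s = "input_store n G x Y"
    have le: "?s a j \<le> n" for a j
      using \<open>x < n\<close> by (intro input_store_le) auto
    have "?s ''n'' 0 = n" by (simp add: input_store_def)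
    moreover have "1 \<le> n" using \<open>x < n\<close> by simp
    ultimately have "\<exists>t\<le>steps n generating_prog.
        run (word_length 60 n) (compile generating_prog) ?s t (exec generating_prog ?s)"
      using run_exec[of 60 generating_prog ?s n, OF admissible_generating_prog le _ _ word_length_sufficient]
      by blast
    then
    obtain t where "t \<le> steps n generating_prog"
        "run (word_length 60 n) (compile generating_prog) ?s t (exec generating_prog ?s)"
      by blast
    then show "\<exists>t s. run (word_length 60 n) (compile generating_prog) ?s t s \<and>
        t \<le> steps n generating_prog \<and> correct_output G {x} Y s"
      using generating_prog_correct[OF star] asm by blast
  qed
qed

end
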